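(* Let $K$ be any field and let $A$ be a finitely generated amenable $K$-algebra without zero divisors. Then there is a unique conjugacy class of linear sofic representations of $A$. That is, $A$ admits a linear sofic representation, and any two linear sofic representations $\phi_k,\psi_k : A\to M_{n_k}(K)$ (with the same sequence of dimensions $(n_k)$) are conjugate.
   Context: Algebras are associative and unital. Fix a finite generating set $S$ of $A$ with $1\in S$. For $r\in\mathbb{N}$, $S^r$ is the set of all monomials of length at most $r$ in $S$, and $A_{\le r}=\mathrm{span}_K(S^r)$. Amenable algebra: a finitely generated $K$-algebra $A$ is amenable if there is a sequence of finite-dimensional linear subspaces $W_1\subseteq W_2\subseteq\cdots$ with $\bigcup_n W_n=A$ such that for every nonzero finite-dimensional subspace $V\le A$, $\dim_K(VW_n)/\dim_K(W_n)\to 1$ as $n\to\infty$, where $VW$ is the span of all products $vw$, $v\in V$, $w\in W$. Normalized rank: for $X\in M_n(K)$, $rk(X)=\frac1n \mathrm{rank}(X)$. $d$-approximation ($d\in\mathbb{N}$, $d\ge1$): a $K$-linear map $\phi:A\to M_n(K)$ is a $d$-approximation of $(A,S)$ if there is a subspace $U\le K^n$ such that: (i) $\phi(xy)u=\phi(x)\phi(y)u$ for all $x,y\in A_{\le d}$ and $u\in U$; (ii) $\dim U\ge(1-\frac1d)n$; (iii) $rk(\phi(a))\ge 1-\frac1d$ for every nonzero $a\in A_{\le d}$. Linear sofic representation: a sequence of $K$-linear maps $\phi_k:A\to M_{n_k}(K)$, $k\in\mathbb{N}$, such that for every $d\in\mathbb{N}$, $\phi_k$ is a $d$-approximation of $(A,S)$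 for all large enough $k$. Conjugacy: fix a nonprincipal ultrafilter $\omega$ on $\mathbb{N}$. For a sequence $(n_k)$ let $\mathcal{N}_\omega=\{(x_k)\in\prod_k M_{n_k}(K) : \lim_{k\to\omega} rk(x_k)=0\}$, a two-sided ideal, and let $\prod_{k\to\omega}M_{n_k}(K)=\prod_k M_{n_k}(K)/\mathcal{N}_\omega$; let $\prod_{k\to\omega}GL_{n_k}(K)$ be its group of invertible elements. Two sequences $\phi_k,\psi_k:A\to M_{n_k}(K)$ are conjugate if there is $M\in\prod_{k\to\omega}GL_{n_k}(K)$ such that for all $a\in A$ the classes of $(\phi_k(a))_k$ and $(\psi_k(a))_k$ satisfy $(\phi_k(a))_k=M(\psi_k(a))_kM^{-1}$ in $\prod_{k\to\omega}M_{n_k}(K)$. *)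

theory Defs
  imports
    Complex_Main
    "HOL-Algebra.QuotRing"
    "Jordan_Normal_Form.Matrix"
    "Jordan_Normal_Form.DL_Rank"
begin

definition normalized_rank :: "nat \<Rightarrow> 'k::field mat \<Rightarrow> real" where
  "normalized_rank n X = real (vec_space.rank n X) / real n"

locale assoc_algebra = vector_space scale
  for scale :: "'k::field \<Rightarrow> 'a::ring_1 \<Rightarrow> 'a" +
  assumes scale_mult_left: "scale c x * y = scale c (x * y)"
    and scale_mult_right: "x * scale c y = scale c (x * y)"
begin

definition monomials :: "'a set \<Rightarrow> nat \<Rightarrow> 'a set" where
  "monomials S r = {prod_list xs |xs. set xs \<subseteq> S \<and> length xs \<le> r}"

definition filtration :: "'a set \<Rightarrow> nat \<Rightarrow> 'a set" where
  "filtration S r = span (monomials S r)"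

definition generating_set :: "'a set \<Rightarrow> bool" where
  "generating_set S \<longleftrightarrow> span (\<Union>r. monomials S r) = UNIV"

definition fin_dim_subspace :: "'a set \<Rightarrow> bool" where
  "fin_dim_subspace V \<longleftrightarrow> subspace V \<and> (\<exists>B. finite B \<and> V \<subseteq> span B)"

definition prod_space :: "'a set \<Rightarrow> 'a set \<Rightarrow> 'a set" where
  "prod_space V W = span {v * w |v w. v \<in> V \<and> w \<in> W}"

definition amenable :: bool where
  "amenable \<longleftrightarrow>
    (\<exists>W :: nat \<Rightarrow> 'a set.
      (\<forall>n. fin_dim_subspace (W n)) \<and>
      (\<forall>n. W n \<subseteq> W (Suc n)) \<and>
      (\<Union>n. W n) = UNIV \<and>
      (\<forall>V. fin_dim_subspace V \<and> V \<noteq> {0} \<longrightarrow>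
        (\<lambda>n. real (dim (prod_space V (W n))) / real (dim (W n))) \<longlonglongrightarrow> 1))"

definition linear_to_mat :: "nat \<Rightarrow> ('a \<Rightarrow> 'k mat) \<Rightarrow> bool" where
  "linear_to_mat n \<phi> \<longleftrightarrow>
    (\<forall>a. \<phi> a \<in> carrier_mat n n) \<and>
    (\<forall>a b. \<phi> (a + b) = \<phi> a + \<phi> b) \<and>
    (\<forall>c a. \<phi> (scale c a) = c \<cdot>\<^sub>m \<phi> a)"

definition approximation_of :: "'a set \<Rightarrow> nat \<Rightarrow> nat \<Rightarrow> ('a \<Rightarrow> 'k mat) \<Rightarrow> bool" where
  "approximation_of S d n \<phi> \<longleftrightarrow>
    linear_to_mat n \<phi> \<and>
    (\<exists>U. VectorSpace.subspace class_ring U (module_vec TYPE('k) n) \<and>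
      (\<forall>x\<in>filtration S d. \<forall>y\<in>filtration S d. \<forall>u\<in>U.
        \<phi> (x * y) *\<^sub>v u = (\<phi> x * \<phi> y) *\<^sub>v u) \<and>
      real (vectorspace.dim class_ring (module_vec TYPE('k) n\<lparr>carrier := U\<rparr>))
        \<ge> (1 - 1 / real d) * real n \<and>
      (\<forall>a\<in>filtration S d. a \<noteq> 0 \<longrightarrow> normalized_rank n (\<phi> a) \<ge> 1 - 1 / real d))"

text \<open>The matrix sizes are required to be positive, so that the normalized rank makes sense.\<close>

definition linear_sofic_rep :: "'a set \<Rightarrow> (nat \<Rightarrow> nat) \<Rightarrow> (nat \<Rightarrow> 'a \<Rightarrow> 'k mat) \<Rightarrow> bool" where
  "linear_sofic_rep S n \<phi> \<longleftrightarrow>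
    (\<forall>k. n k > 0 \<and> linear_to_mat (n k) (\<phi> k)) \<and>
    (\<forall>d\<ge>1. eventually (\<lambda>k. approximation_of S d (n k) (\<phi> k)) sequentially)"

end

text \<open>An ultrafilter is identified with the filter whose eventually true predicates are its members.\<close>

definition nonprincipal_ultrafilter :: "nat filter \<Rightarrow> bool" where
  "nonprincipal_ultrafilter \<omega> \<longleftrightarrow>
    \<omega> \<noteq> bot \<and>
    (\<forall>P. eventually P \<omega> \<or> eventually (\<lambda>k. \<not> P k) \<omega>) \<and>
    (\<forall>m. \<not> eventually (\<lambda>k. k = m) \<omega>)"

definition mat_seq_ring :: "(nat \<Rightarrow> nat) \<Rightarrow> (nat \<Rightarrow> 'k::field mat) ring" where
  "mat_seq_ring n =
    \<lparr>carrier = {x. \<forall>k. x k \<in> carrier_mat (n k) (n k)},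
     mult = (\<lambda>x y k. x k * y k),
     one = (\<lambda>k. 1\<^sub>m (n k)),
     zero = (\<lambda>k. 0\<^sub>m (n k) (n k)),
     add = (\<lambda>x y k. x k + y k)\<rparr>"

definition null_ideal :: "nat filter \<Rightarrow> (nat \<Rightarrow> nat) \<Rightarrow> (nat \<Rightarrow> 'k::field mat) set" where
  "null_ideal \<omega> n =
    {x \<in> carrier (mat_seq_ring n). ((\<lambda>k. normalized_rank (n k) (x k)) \<longlongrightarrow> 0) \<omega>}"

definition mat_ultraproduct ::
    "nat filter \<Rightarrow> (nat \<Rightarrow> nat) \<Rightarrow> (nat \<Rightarrow> 'k::field mat) set ring" where
  "mat_ultraproduct \<omega> n = mat_seq_ring n Quot null_ideal \<omega> n"

definition ultra_class ::
    "nat filter \<Rightarrow> (nat \<Rightarrow> nat) \<Rightarrow> (nat \<Rightarrow> 'k::field mat) \<Rightarrow> (nat \<Rightarrow> 'k mat) set" where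
  "ultra_class \<omega> n x = null_ideal \<omega> n +>\<^bsub>mat_seq_ring n\<^esub> x"

definition conjugate ::
    "nat filter \<Rightarrow> (nat \<Rightarrow> nat) \<Rightarrow>
      (nat \<Rightarrow> 'a \<Rightarrow> 'k::field mat) \<Rightarrow> (nat \<Rightarrow> 'a \<Rightarrow> 'k mat) \<Rightarrow> bool" where
  "conjugate \<omega> n \<phi> \<psi> \<longleftrightarrow>
    (\<exists>M \<in> Units (mat_ultraproduct \<omega> n). \<forall>a.
      ultra_class \<omega> n (\<lambda>k. \<phi> k a) =
        M \<otimes>\<^bsub>mat_ultraproduct \<omega> n\<^esub> ultra_class \<omega> n (\<lambda>k. \<psi> k a)
          \<otimes>\<^bsub>mat_ultraproduct \<omega> n\<^esub> (inv\<^bsub>mat_ultraproduct \<omega> n\<^esub> M))"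

end

theory Submission
  imports Defs "HOL-Library.Function_Algebras"
begin

text \<open>
Uniqueness rests on filling \<open>K\<^sup>n\<close> greedily with copies of a single subspace \<open>W\<close> of the algebra \<open>A\<close>.
Let \<open>\<phi>\<close> be a \<open>d\<close>-approximation with \<open>d\<close> large, and let \<open>v\<^sub>1, \<dots>, v\<^sub>m\<close> be vectors, lying in the
subspace \<open>U\<close> on which \<open>\<phi>\<close> is multiplicative, such that \<open>(w\<^sub>i) \<mapsto> \<Sum>\<^sub>i \<phi>(w\<^sub>i) v\<^sub>i\<close> is injective on
\<open>W\<^sup>m\<close>; let \<open>E\<close> be its image. As long as \<open>dim E < (1 - \<epsilon>) n\<close>, every nonzero \<open>w\<close> in \<open>W\<close> maps \<open>U\<close> onto
a space of dimension nearly \<open>n\<close>, hence not into any space of dimension just above that of \<open>E\<close>. The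
main lemma, \<open>generic_vector\<close>, turns this statement about one \<open>w\<close> at a time into a single vector
\<open>v \<in> U\<close> for which \<open>w \<mapsto> \<phi>(w) v\<close> is injective modulo \<open>E\<close>, so that another copy of \<open>W\<close> can be added.
It is a local linear dependence result, proved by a minimality argument that is valid over
finite fields too.

If two representations of the same dimension are filled with the same number of copies of \<open>W\<close>,
the map that matches the copies extends to an automorphism \<open>h\<close> of \<open>K\<^sup>n\<close>
(\<open>tiling_isomorphism\<close>). For \<open>a\<close> in \<open>A\<close> it intertwines the two actions of \<open>a\<close> on the copies of
\<open>{w \<in> W. a w \<in> W}\<close>, because there both representations multiply correctly. If \<open>W\<close> comes from
amenability, this subspace is almost all of \<open>W\<close>, so the defect of \<open>h\<close> has small normalized rank
(\<open>eventually_intertwiner\<close>). Letting the precision improve slowly with \<open>k\<close> gives one sequence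
of invertible matrices that works for all \<open>a\<close>.

The main lemma needs \<open>n\<close> to be large compared with \<open>dim W\<close>. If \<open>A\<close> has infinite dimension, then
\<open>n\<^sub>k\<close> tends to infinity, because \<open>\<phi>\<^sub>k\<close> is injective on larger and larger subspaces. If \<open>A\<close> has
finite dimension, \<open>W = A\<close> is chosen; when \<open>n\<^sub>k\<close> is small, an approximation of large precision is an
exact action on all of \<open>K\<^sup>n\<close>, the image \<open>E\<close> is a submodule, and any vector outside \<open>E\<close> will do.

For existence, left multiplication is compressed to the subspaces \<open>W\<^sub>k\<close> given by amenability. It is
multiplicative on those \<open>w\<close> which short words do not move out of \<open>W\<^sub>k\<close>, and nonzero elements have
nearly full rank since \<open>A\<close> has no zero divisors.

Dimension theory is that of vector spaces over a type: vectors of length \<open>n\<close> are represented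
by functions on the naturals that vanish from \<open>n\<close> on (\<open>coord_space n\<close>), and matrices by operators
on such functions. The lemmas \<open>dim_vec_seq\<close> and \<open>rank_eq_dim_range\<close> compare the dimensions and ranks in the
definitions with this model.
\<close>

section \<open>Finite-dimensional subspaces\<close>

text \<open>A copy of \<open>vector_space\<close> without global interpretation, so that names declared here are not hidden
by their instances for real vector spaces.\<close>

locale linear_space = vector_space scale
  for scale :: "'k::field \<Rightarrow> 'b::ab_group_add \<Rightarrow> 'b"
begin

definition fin_dim :: "'b set \<Rightarrow> bool" where
  "fin_dim V \<longleftrightarrow> (\<exists>B. finite B \<and> V \<subseteq> span B)"

lemma fin_dim_subset: "V \<subseteq> W \<Longrightarrow> fin_dim W \<Longrightarrow> fin_dim V"
  unfolding fin_dim_def by blast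

lemma fin_dim_span: "fin_dim V \<Longrightarrow> fin_dim (span V)"
  unfolding fin_dim_def using span_minimal by blast

lemma fin_dim_Un: "fin_dim V \<Longrightarrow> fin_dim W \<Longrightarrow> fin_dim (V \<union> W)"
proof -
  assume "fin_dim V" "fin_dim W"
  then obtain B C where "finite B" "V \<subseteq> span B" "finite C" "W \<subseteq> span C"
    unfolding fin_dim_def by blast
  then have "finite (B \<union> C)" "V \<union> W \<subseteq> span (B \<union> C)"
    using span_mono[of B "B \<union> C"] span_mono[of C "B \<union> C"] by auto
  then show ?thesis
    unfolding fin_dim_def by blast
qed

lemma fin_dim_basis:
  assumes "fin_dim V" "subspace V"
  obtains B where "finite B" "independent B" "span B = V" "card B = dim V"
proof -
  obtain B where B: "B \<subseteq> V" "independent B" "V \<subseteq> span B" "card B = dim V"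
    by (rule basis_exists)
  obtain C where "finite C" "V \<subseteq> span C"
    using assms(1) unfolding fin_dim_def by blast
  then have "finite B"
    using independent_span_bound[of C B] B by blast
  then show ?thesis
    using that B assms(2) span_minimal[OF B(1) assms(2)] by blast
qed

lemma fin_dim_dim_mono:
  assumes "V \<subseteq> W" "fin_dim W"
  shows "dim V \<le> dim W"
proof -
  obtain B where B: "B \<subseteq> V" "independent B" "V \<subseteq> span B" "card B = dim V"
    by (rule basis_exists)
  obtain C where C: "finite C" "independent C" "span C = span W" "card C = dim (span W)"
    using fin_dim_basis[OF fin_dim_span[OF assms(2)] subspace_span] by blast
  have "B \<subseteq> span C"
    using B assms C span_superset[of W] by auto
  then show ?thesis
    using independent_span_bound[OF C(1) B(2)] B C by simp
qed

lemma dim_eq_0_imp: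
  assumes "fin_dim V" "dim V = 0"
  shows "V \<subseteq> {0}"
proof -
  obtain B where B: "finite B" "independent B" "span B = span V" "card B = dim (span V)"
    using fin_dim_basis[OF fin_dim_span[OF assms(1)] subspace_span] by blast
  then have "B = {}"
    using assms by simp
  then show ?thesis
    using B span_superset[of V] by auto
qed

lemma dim_zero_subspace: "dim {0} = 0"
  using dim_eq_card[of "{}" "{0}"] independent_empty by simp

lemma subspace_eqI_dim:
  assumes "V \<subseteq> W" "subspace V" "fin_dim W" "dim W \<le> dim V"
  shows "V = W"
proof (rule ccontr)
  assume "V \<noteq> W"
  then obtain x where x: "x \<in> W" "x \<notin> V"
    using assms by blast
  obtain B where B: "finite B" "independent B" "span B = V" "card B = dim V"
    using fin_dim_basis[OF fin_dim_subset[OF assms(1,3)] assms(2)] by blast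
  have "independent (insert x B)" "x \<notin> B"
    using independent_insertI[of x B] B x span_base[of x B] by auto
  moreover have "insert x B \<subseteq> W"
    using B x assms span_superset[of B] by auto
  ultimately have "card (insert x B) \<le> dim W"
    using fin_dim_dim_mono[of "insert x B" W] dim_eq_card_independent assms by metis
  then show False
    using B assms \<open>x \<notin> B\<close> by simp
qed

end

locale linear_space_pair = vs1: linear_space s1 + vs2: linear_space s2
  for s1 :: "'k::field \<Rightarrow> 'b::ab_group_add \<Rightarrow> 'b"
  and s2 :: "'k::field \<Rightarrow> 'c::ab_group_add \<Rightarrow> 'c"
begin

sublocale vector_space_pair s1 s2 ..

lemma fin_dim_image:
  assumes "Vector_Spaces.linear s1 s2 f" "vs1.fin_dim V"
  shows "vs2.fin_dim (f ` V)"
  using assms linear_spans_image[OF assms(1)] unfolding vs1.fin_dim_def vs2.fin_dim_def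
  by (meson finite_imageI)

lemma rank_nullity:
  assumes f: "Vector_Spaces.linear s1 s2 f" and V: "vs1.subspace V" "vs1.fin_dim V"
  shows "vs1.dim V = vs2.dim (f ` V) + vs1.dim {x \<in> V. f x = 0}"
proof -
  let ?K = "{x \<in> V. f x = 0}"
  have sK: "vs1.subspace ?K"
    using vs1.subspace_inter[OF V(1) linear_subspace_kernel[OF f]]
    by (simp add: Int_def)
  have fK: "vs1.fin_dim ?K"
    by (rule vs1.fin_dim_subset[OF _ V(2)]) auto
  obtain B where B: "finite B" "vs1.independent B" "vs1.span B = ?K" "card B = vs1.dim ?K"
    using vs1.fin_dim_basis[OF fK sK] by blast
  have "B \<subseteq> V"
    using B(3) vs1.span_superset[of B] by blast
  then obtain T where T: "B \<subseteq> T" "T \<subseteq> V" "vs1.independent T" "V \<subseteq> vs1.span T"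
    using vs1.maximal_independent_subset_extend[OF _ B(2)] by blast
  have cT: "card T = vs1.dim V"
    using T vs1.basis_card_eq_dim by blast
  obtain D where "finite D" "V \<subseteq> vs1.span D"
    using V(2) unfolding vs1.fin_dim_def by blast
  then have fT: "finite T"
    using vs1.independent_span_bound[of D T] T by blast
  have sT: "vs1.span T = V"
    using T V(1) vs1.span_minimal by blast
  define C where "C = T - B"
  \<comment> \<open>The projection \<open>q\<close> to the span of \<open>B\<close> along the span of \<open>C\<close> shows that these meet only in \<open>0\<close>, so
    that \<open>f\<close>, whose kernel on \<open>V\<close> is the span of \<open>B\<close>, is injective on the span of \<open>C\<close>.\<close>
  interpret e: linear_space_pair s1 s1 ..
  define q where "q = e.construct T (\<lambda>b. if b \<in> B then b else 0)"
  have lq: "Vector_Spaces.linear s1 s1 q"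
    unfolding q_def using e.linear_construct[OF T(3)] .
  have qB: "q x = x" if "x \<in> vs1.span B" for x
  proof (rule e.linear_eq_on[OF lq _ that])
    show "Vector_Spaces.linear s1 s1 (\<lambda>x. x)"
      by (rule vs1.module_hom_ident)
    show "q b = b" if "b \<in> B" for b
      using T(1) that by (auto simp: q_def e.construct_basis[OF T(3)])
  qed
  have qC: "q x = 0" if "x \<in> vs1.span C" for x
    using e.linear_eq_0_on_span[OF lq _ that]
    by (auto simp: q_def C_def e.construct_basis[OF T(3)])
  have inj: "inj_on f (vs1.span C)"
  proof (subst linear_inj_on_iff_eq_0[OF f], simp, intro ballI impI)
    fix x assume x: "x \<in> vs1.span C" "f x = 0"
    have "x \<in> V"
      using x(1) vs1.span_mono[of C T] sT unfolding C_def by blast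
    then have "x \<in> vs1.span B"
      using x B by blast
    then show "x = 0"
      using qB qC x(1) by metis
  qed
  have "vs1.independent C"
    using T(3) vs1.independent_mono C_def by blast
  then have iC: "vs2.independent (f ` C)"
    using linear_independent_injective_image[OF f _ inj] by blast
  have spC: "vs2.span (f ` C) = f ` V"
  proof -
    have "vs2.span (f ` T) = f ` V"
      using linear_span_image[OF f, of T] sT by simp
    moreover have "f ` T \<subseteq> insert 0 (f ` C)"
      using B(3) vs1.span_superset[of B] unfolding C_def by auto
    moreover have "f ` C \<subseteq> f ` T"
      unfolding C_def by blast
    ultimately show ?thesis
      by (metis vs2.span_insert_0 vs2.span_mono subset_antisym)
  qed
  have "vs2.dim (f ` V) = card (f ` C)"
    using vs2.dim_eq_card[OF _ iC, of "f ` V"] spC vs2.span_span by metis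
  also have "\<dots> = card C"
    by (rule card_image) (rule inj_on_subset[OF inj vs1.span_superset])
  finally show ?thesis
    using cT B(4) card_Diff_subset[OF B(1) T(1)] card_mono[OF fT T(1)]
    unfolding C_def by simp
qed

lemma dim_image_inj:
  assumes "Vector_Spaces.linear s1 s2 f" "vs1.subspace V" "vs1.fin_dim V"
    and "\<And>x. x \<in> V \<Longrightarrow> f x = 0 \<Longrightarrow> x = 0"
  shows "vs2.dim (f ` V) = vs1.dim V"
proof -
  have "{x \<in> V. f x = 0} = {0}"
    using assms linear_0[OF assms(1)] vs1.subspace_0[OF assms(2)] by auto
  then show ?thesis
    using rank_nullity[OF assms(1-3)] by (simp add: vs1.dim_zero_subspace)
qed

lemma dim_image_le:
  assumes "Vector_Spaces.linear s1 s2 f" "vs1.subspace V" "vs1.fin_dim V"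
  shows "vs2.dim (f ` V) \<le> vs1.dim V"
  using rank_nullity[OF assms] by simp

end

lemma (in linear_space) exists_quotient_map:
  assumes "subspace E"
  shows "\<exists>p. Vector_Spaces.linear scale scale p \<and> (\<forall>x. p x = 0 \<longleftrightarrow> x \<in> E)"
proof -
  interpret e: linear_space_pair scale scale ..
  obtain q where q: "range q \<subseteq> E" "Vector_Spaces.linear scale scale q" "\<And>v. v \<in> E \<Longrightarrow> q v = v"
    using e.linear_exists_left_inverse_on[OF module_hom_ident assms] by (auto simp: inj_on_def)
  have "Vector_Spaces.linear scale scale (\<lambda>x. x - q x)"
    by (intro e.linear_compose_sub module_hom_ident q)
  moreover have "x - q x = 0 \<longleftrightarrow> x \<in> E" for x
    using q(1) q(3)[of x] by (metis eq_iff_diff_eq_0 rangeI subsetD)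
  ultimately show ?thesis by blast
qed

text \<open>In the quotient of \<open>F\<close> by \<open>E\<close>, the image of \<open>V\<close> has dimension \<open>dim V - dim {x \<in> V. f x \<in> E}\<close>, and this is at
most \<open>dim F - dim E\<close>.\<close>

lemma (in linear_space_pair) dim_preimage:
  assumes f: "Vector_Spaces.linear s1 s2 f" and V: "vs1.subspace V" "vs1.fin_dim V"
    and F: "vs2.subspace F" "vs2.fin_dim F" "f ` V \<subseteq> F"
    and E: "vs2.subspace E" "E \<subseteq> F"
  shows "vs1.dim V + vs2.dim E \<le> vs1.dim {x \<in> V. f x \<in> E} + vs2.dim F"
proof -
  obtain p where p: "Vector_Spaces.linear s2 s2 p" "\<And>x. p x = 0 \<longleftrightarrow> x \<in> E"
    using vs2.exists_quotient_map[OF E(1)] by blast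
  interpret e: linear_space_pair s2 s2 ..
  have "Vector_Spaces.linear s1 s2 (p \<circ> f)"
    using Vector_Spaces.linear_compose[OF f p(1)] .
  from rank_nullity[OF this V]
  have "vs1.dim V = vs2.dim (p ` f ` V) + vs1.dim {x \<in> V. f x \<in> E}"
    by (simp add: p image_comp comp_def)
  moreover have "{x \<in> F. x \<in> E} = E"
    using E(2) by blast
  then have "vs2.dim F = vs2.dim (p ` F) + vs2.dim E"
    using e.rank_nullity[OF p(1) F(1,2)] by (simp add: p)
  moreover have "vs2.dim (p ` f ` V) \<le> vs2.dim (p ` F)"
    using F by (intro vs2.fin_dim_dim_mono e.fin_dim_image p) auto
  ultimately show ?thesis by simp
qed

lemma (in linear_space) dim_span_Un_disjoint:
  assumes "subspace V" "subspace W" "fin_dim V" "fin_dim W" "V \<inter> W \<subseteq> {0}"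
  shows "dim (span (V \<union> W)) = dim V + dim W"
proof -
  obtain p where p: "Vector_Spaces.linear scale scale p" "\<And>x. p x = 0 \<longleftrightarrow> x \<in> W"
    using exists_quotient_map[OF assms(2)] by blast
  interpret e: linear_space_pair scale scale ..
  let ?S = "span (V \<union> W)"
  have "fin_dim ?S"
    using assms by (intro fin_dim_span fin_dim_Un)
  from e.rank_nullity[OF p(1) subspace_span this]
  have "dim ?S = dim (p ` ?S) + dim {x \<in> ?S. x \<in> W}"
    by (simp add: p)
  moreover have "{x \<in> ?S. x \<in> W} = W"
    using span_superset by fastforce
  moreover have "p ` ?S = p ` V"
  proof -
    have "p ` W = {0}"
      using p subspace_0[OF assms(2)] by force
    then have "p ` (V \<union> W) = p ` V"
      using p(2)[of 0] subspace_0[OF assms(1)] subspace_0[OF assms(2)] by (force simp: image_Un)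
    then show ?thesis
      using e.linear_span_image[OF p(1)] assms(1) by (metis span_eq_iff)
  qed
  moreover have "dim (p ` V) = dim V"
    using e.dim_image_inj[OF p(1) assms(1,3)] assms(5) p(2) by blast
  ultimately show ?thesis by simp
qed

lemma (in linear_space) dim_span_Un_le:
  assumes "fin_dim V" "fin_dim W"
  shows "dim (span (V \<union> W)) \<le> dim V + dim W"
proof -
  obtain B where B: "finite B" "span B = span V" "card B = dim V"
    using fin_dim_basis[OF fin_dim_span[OF assms(1)] subspace_span] by (metis dim_span)
  obtain C where C: "finite C" "span C = span W" "card C = dim W"
    using fin_dim_basis[OF fin_dim_span[OF assms(2)] subspace_span] by (metis dim_span)
  have "V \<union> W \<subseteq> span (B \<union> C)"
    using B C span_superset[of V] span_superset[of W] span_mono[of B "B \<union> C"] span_mono[of C "B \<union> C"]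
    by blast
  then have "dim (V \<union> W) \<le> card (B \<union> C)"
    using B C by (intro dim_le_card) auto
  also have "\<dots> \<le> card B + card C"
    by (rule card_Un_le)
  finally show ?thesis
    using B C by simp
qed

text \<open>The inverse is produced together with the automorphism because both are needed as
matrices.\<close>

lemma (in linear_space) extend_bijection_to_automorphism:
  assumes F: "subspace F" "fin_dim F"
    and X: "X \<subseteq> F" "independent X" and Y: "Y \<subseteq> F" "independent Y"
    and bij: "bij_betw \<theta> X Y"
  obtains h h' where "Vector_Spaces.linear scale scale h" "Vector_Spaces.linear scale scale h'"
    "h ` F \<subseteq> F" "h' ` F \<subseteq> F"
    "\<And>x. x \<in> F \<Longrightarrow> h (h' x) = x" "\<And>x. x \<in> F \<Longrightarrow> h' (h x) = x"
    "\<And>x. x \<in> X \<Longrightarrow> h x = \<theta> x"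
proof -
  interpret e: linear_space_pair scale scale ..
  obtain D where D: "finite D" "F \<subseteq> span D"
    using F(2) unfolding fin_dim_def by blast
  obtain X' where X': "X \<subseteq> X'" "X' \<subseteq> F" "independent X'" "F \<subseteq> span X'"
    using maximal_independent_subset_extend[OF X] by blast
  obtain Y' where Y': "Y \<subseteq> Y'" "Y' \<subseteq> F" "independent Y'" "F \<subseteq> span Y'"
    using maximal_independent_subset_extend[OF Y] by blast
  have fin: "finite X'" "finite Y'"
    using independent_span_bound[OF D(1) X'(3)] independent_span_bound[OF D(1) Y'(3)] D(2) X'(2) Y'(2)
    by blast+
  have "card X' = card Y'"
    using basis_card_eq_dim[OF X'(2,4,3)] basis_card_eq_dim[OF Y'(2,4,3)] by simp
  moreover have "card X = card Y"
    using bij bij_betw_same_card by blast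
  ultimately have "card (X' - X) = card (Y' - Y)"
    using fin X' Y' by (simp add: card_Diff_subset finite_subset)
  then obtain \<eta> where \<eta>: "bij_betw \<eta> (X' - X) (Y' - Y)"
    using fin finite_same_card_bij by (metis finite_Diff)
  define \<rho> where "\<rho> x = (if x \<in> X then \<theta> x else \<eta> x)" for x
  have "bij_betw \<rho> (X \<union> (X' - X)) (Y \<union> (Y' - Y))"
  proof (rule bij_betw_combine)
    show "bij_betw \<rho> X Y"
      using bij by (rule bij_betw_cong[THEN iffD1, rotated]) (simp add: \<rho>_def)
    show "bij_betw \<rho> (X' - X) (Y' - Y)"
      using \<eta> by (rule bij_betw_cong[THEN iffD1, rotated]) (simp add: \<rho>_def)
  qed auto
  then have \<rho>: "bij_betw \<rho> X' Y'"
    using X' Y' by (simp add: Un_absorb1)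
  define h where "h = e.construct X' \<rho>"
  define h' where "h' = e.construct Y' (inv_into X' \<rho>)"
  have lin: "Vector_Spaces.linear scale scale h" "Vector_Spaces.linear scale scale h'"
    unfolding h_def h'_def using e.linear_construct X' Y' by auto
  have hX: "h x = \<rho> x" if "x \<in> X'" for x
    unfolding h_def using e.construct_basis X' that by blast
  have hY: "h' y = inv_into X' \<rho> y" if "y \<in> Y'" for y
    unfolding h'_def using e.construct_basis Y' that by blast
  have "h ` F \<subseteq> F"
  proof -
    have "h x \<in> span (\<rho> ` X')" for x
      unfolding h_def using e.construct_in_span X' by blast
    moreover have "span (\<rho> ` X') \<subseteq> F"
      using \<rho> Y' F by (intro span_minimal) (auto simp: bij_betw_def)
    ultimately show ?thesis by blast
  qed
  moreover have "h' ` F \<subseteq> F"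
  proof -
    have "h' x \<in> span (inv_into X' \<rho> ` Y')" for x
      unfolding h'_def using e.construct_in_span Y' by blast
    moreover have "span (inv_into X' \<rho> ` Y') \<subseteq> F"
      using bij_betw_inv_into[OF \<rho>] X' F by (intro span_minimal) (auto simp: bij_betw_def)
    ultimately show ?thesis by blast
  qed
  moreover have "h (h' x) = x" if "x \<in> F" for x
  proof -
    have "(h \<circ> h') x = x"
    proof (rule e.linear_eq_on)
      show "Vector_Spaces.linear scale scale (h \<circ> h')"
        using Vector_Spaces.linear_compose lin by blast
      show "x \<in> span Y'"
        using that Y' by blast
      show "(h \<circ> h') y = y" if "y \<in> Y'" for y
        using that hX hY \<rho> by (simp add: bij_betw_inv_into_right bij_betw_imp_surj_on inv_into_into)
    qed (rule module_hom_ident)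
    then show ?thesis by simp
  qed
  moreover have "h' (h x) = x" if "x \<in> F" for x
  proof -
    have "(h' \<circ> h) x = x"
    proof (rule e.linear_eq_on)
      show "Vector_Spaces.linear scale scale (h' \<circ> h)"
        using Vector_Spaces.linear_compose lin by blast
      show "x \<in> span X'"
        using that X' by blast
      show "(h' \<circ> h) y = y" if "y \<in> X'" for y
        using that hX hY \<rho> by (simp add: bij_betw_inv_into_left bij_betw_apply)
    qed (rule module_hom_ident)
    then show ?thesis by simp
  qed
  moreover have "h x = \<theta> x" if "x \<in> X" for x
    using hX X' that by (auto simp: \<rho>_def)
  ultimately show ?thesis
    using that[of h h'] lin by simp
qed

section \<open>Generic vectors\<close>

locale linear_action = linear_space_pair s1 s2
  for s1 :: "'k::field \<Rightarrow> 'b::ab_group_add \<Rightarrow> 'b"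
  and s2 :: "'k::field \<Rightarrow> 'c::ab_group_add \<Rightarrow> 'c" +
  fixes act :: "'b \<Rightarrow> 'c \<Rightarrow> 'c"
  assumes linear_left: "Vector_Spaces.linear s1 s2 (\<lambda>w. act w v)"
    and linear_right: "Vector_Spaces.linear s2 s2 (act w)"
begin

lemma act_add_right: "act w (u + v) = act w u + act w v"
  using linear_right[of w] by (simp add: Vector_Spaces.linear_iff)

definition annihilator :: "'b set \<Rightarrow> 'c set \<Rightarrow> 'c \<Rightarrow> 'b set" where
  "annihilator W E v = {w \<in> W. act w v \<in> E}"

lemma subspace_annihilator:
  assumes "vs1.subspace W" "vs2.subspace E"
  shows "vs1.subspace (annihilator W E v)"
  using vs1.subspace_inter[OF assms(1) linear_subspace_linear_preimage[OF linear_left assms(2)]]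
  by (simp add: annihilator_def Int_def)

text \<open>Write \<open>D = dim W\<close>. The hypothesis says that no nonzero element of \<open>W\<close> maps \<open>U\<close> into a space of
dimension at most \<open>N\<close>. The induction on \<open>j\<close> lowers the least possible dimension of
\<open>annihilator W E v\<close> by one, at the price of \<open>2 D\<close> in the admissible dimension of \<open>E\<close>. If it cannot be
lowered for some \<open>E\<close>, then this least dimension is the same number \<open>k\<close> for \<open>E\<close> and for all slightly
larger spaces. Choosing \<open>u\<close> minimal for a larger space that contains \<open>W y\<close> gives
\<open>annihilator W E (u + y) = annihilator W E u\<close>, so that elements killing \<open>u\<close> modulo \<open>E\<close> also kill \<open>y\<close>
modulo \<open>E\<close>. Applied to every \<open>y\<close> of \<open>U\<close>, this yields a nonzero element of \<open>W\<close> that maps all of \<open>U\<close> into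
\<open>E\<close>, contrary to the hypothesis.\<close>

lemma generic_vector_induct:
  assumes W: "vs1.subspace W" "vs1.fin_dim W" and U: "vs2.subspace U"
    and big: "\<And>w E. w \<in> W \<Longrightarrow> w \<noteq> 0 \<Longrightarrow> vs2.subspace E \<Longrightarrow> vs2.fin_dim E \<Longrightarrow> vs2.dim E \<le> N
      \<Longrightarrow> \<not> act w ` U \<subseteq> E"
    and E: "vs2.subspace E" "vs2.fin_dim E"
    and j: "j \<le> vs1.dim W" "vs2.dim E + 2 * vs1.dim W * j \<le> N"
  shows "\<exists>v\<in>U. vs1.dim (annihilator W E v) \<le> vs1.dim W - j"
  using E j
proof (induction j arbitrary: E)
  case 0
  have "vs1.dim (annihilator W E 0) \<le> vs1.dim W"
    using W by (intro vs1.fin_dim_dim_mono) (auto simp: annihilator_def)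
  then show ?case
    using vs2.subspace_0[OF U] by auto
next
  case (Suc j)
  let ?D = "vs1.dim W"
  define k where "k = ?D - j"
  have "k \<ge> 1" and jD: "j \<le> ?D"
    using Suc.prems unfolding k_def by auto
  show ?case
  proof (rule ccontr)
    assume "\<not> ?thesis"
    then have ge: "vs1.dim (annihilator W E v) \<ge> k" if "v \<in> U" for v
      using that unfolding k_def by fastforce
    have fda: "vs1.fin_dim (annihilator W E' v)" for E' v
      by (rule vs1.fin_dim_subset[OF _ W(2)]) (auto simp: annihilator_def)
    \<comment> \<open>Since \<open>k\<close> is a lower bound for \<open>E\<close>, the annihilator of a vector that is minimal for
      \<open>E'\<close> does not shrink when \<open>E'\<close> is replaced by \<open>E\<close>.\<close>
    have good: "\<exists>v\<in>U. annihilator W E' v = annihilator W E v \<and> vs1.dim (annihilator W E v) = k"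
      if E': "vs2.subspace E'" "vs2.fin_dim E'" "E \<subseteq> E'" "vs2.dim E' \<le> vs2.dim E + 2 * ?D" for E'
    proof -
      obtain v where v: "v \<in> U" "vs1.dim (annihilator W E' v) \<le> k"
        using Suc.IH[OF E'(1,2) jD] E'(4) Suc.prems(4) unfolding k_def by auto
      have sub: "annihilator W E v \<subseteq> annihilator W E' v"
        using E'(3) unfolding annihilator_def by auto
      have "annihilator W E v = annihilator W E' v"
        using ge[OF v(1)] v(2)
        by (intro vs1.subspace_eqI_dim[OF sub subspace_annihilator[OF W(1) Suc.prems(1)] fda]) simp
      then show ?thesis
        using v ge[OF v(1)] by (metis le_antisym)
    qed
    obtain v where v: "v \<in> U" "vs1.dim (annihilator W E v) = k"
      using good[OF Suc.prems(1,2)] by auto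
    then have "\<not> annihilator W E v \<subseteq> {0}"
      using vs1.fin_dim_dim_mono[of "annihilator W E v" "{0}"] \<open>k \<ge> 1\<close>
        vs1.fin_dim_subset[OF _ W(2), of "{0}"] vs1.subspace_0[OF W(1)] by (auto simp: vs1.dim_zero_subspace)
    then obtain w0 where w0: "w0 \<in> annihilator W E v" "w0 \<noteq> 0"
      by blast
    \<comment> \<open>Elements that kill \<open>v\<close> modulo \<open>E\<close>, such as \<open>w0\<close>, also kill any other \<open>x\<close> of \<open>U\<close> modulo \<open>E\<close>: the vector
    \<open>u\<close> below is minimal for a space containing both \<open>W x\<close> and \<open>W v\<close>.\<close>
    have "act w0 x \<in> E" if "x \<in> U" for x
    proof -
      define P where "P y = (\<lambda>w. act w y) ` W" for y
      have fP: "vs2.fin_dim (P y)" for y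
        unfolding P_def by (rule fin_dim_image[OF linear_left W(2)])
      have dP: "vs2.dim (P y) \<le> ?D" for y
        unfolding P_def by (rule dim_image_le[OF linear_left W])
      define E' where "E' = vs2.span (E \<union> vs2.span (P x \<union> P v))"
      have "vs2.fin_dim E'"
        unfolding E'_def by (intro vs2.fin_dim_span vs2.fin_dim_Un fP Suc.prems)
      moreover have "vs2.dim E' \<le> vs2.dim E + vs2.dim (vs2.span (P x \<union> P v))"
        unfolding E'_def using vs2.dim_span_Un_le[of E "vs2.span (P x \<union> P v)"]
        by (simp add: vs2.fin_dim_span vs2.fin_dim_Un fP Suc.prems del: vs2.dim_span)
      moreover have "vs2.dim (vs2.span (P x \<union> P v)) \<le> vs2.dim (P x) + vs2.dim (P v)"
        by (rule vs2.dim_span_Un_le[OF fP fP])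
      moreover have sub: "E \<subseteq> E'" "P x \<subseteq> E'" "P v \<subseteq> E'"
        unfolding E'_def using vs2.span_superset[of "E \<union> vs2.span (P x \<union> P v)"]
          vs2.span_superset[of "P x \<union> P v"] by auto
      ultimately obtain u where u: "u \<in> U" "annihilator W E' u = annihilator W E u"
        "vs1.dim (annihilator W E u) = k"
        using good[of E'] dP[of x] dP[of v] unfolding E'_def by auto
      have sE': "vs2.subspace E'"
        unfolding E'_def by simp
      have sub_ann: "annihilator W E u \<subseteq> annihilator W E y" if y: "y \<in> U" "P y \<subseteq> E'" for y
      proof -
        have yu: "u + y \<in> U"
          using U u y vs2.subspace_add by blast
        have "annihilator W E (u + y) \<subseteq> annihilator W E' u"
        proof
          fix w assume w: "w \<in> annihilator W E (u + y)"
          then have "act w u + act w y \<in> E'" "act w y \<in> E'"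
            using sub(1) y(2) unfolding annihilator_def P_def by (auto simp: act_add_right)
          then have "act w u \<in> E'"
            using vs2.subspace_diff[OF sE'] by fastforce
          then show "w \<in> annihilator W E' u"
            using w unfolding annihilator_def by auto
        qed
        then have "annihilator W E (u + y) = annihilator W E u"
          using ge[OF yu] u
          by (intro vs1.subspace_eqI_dim subspace_annihilator W Suc.prems fda) auto
        then have "act w u + act w y \<in> E" if "w \<in> annihilator W E u" for w
          using that unfolding annihilator_def by (auto simp: act_add_right)
        then show ?thesis
          using vs2.subspace_diff[OF Suc.prems(1)] unfolding annihilator_def by fastforce
      qed
      have "annihilator W E u = annihilator W E v"
        using sub_ann[OF v(1) sub(3)] u v
        by (intro vs1.subspace_eqI_dim subspace_annihilator W Suc.prems fda) auto
      then show ?thesis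
        using sub_ann[OF that sub(2)] w0 unfolding annihilator_def by auto
    qed
    then show False
      using big[of w0 E] w0 Suc.prems unfolding annihilator_def by fastforce
  qed
qed

lemma generic_vector:
  assumes W: "vs1.subspace W" "vs1.fin_dim W" and U: "vs2.subspace U"
    and big: "\<And>w E. w \<in> W \<Longrightarrow> w \<noteq> 0 \<Longrightarrow> vs2.subspace E \<Longrightarrow> vs2.fin_dim E \<Longrightarrow> vs2.dim E \<le> N
      \<Longrightarrow> \<not> act w ` U \<subseteq> E"
    and E: "vs2.subspace E" "vs2.fin_dim E" "vs2.dim E + 2 * vs1.dim W * vs1.dim W \<le> N"
  shows "\<exists>v\<in>U. \<forall>w\<in>W. act w v \<in> E \<longrightarrow> w = 0"
proof -
  obtain v where v: "v \<in> U" "vs1.dim (annihilator W E v) = 0"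
    using generic_vector_induct[OF W U big E(1,2) order_refl E(3)] by auto
  moreover have "vs1.fin_dim (annihilator W E v)"
    by (rule vs1.fin_dim_subset[OF _ W(2)]) (auto simp: annihilator_def)
  ultimately show ?thesis
    using vs1.dim_eq_0_imp unfolding annihilator_def by blast
qed

section \<open>Tilings\<close>

definition tile_span :: "'b set \<Rightarrow> 'c list \<Rightarrow> 'c set" where
  "tile_span W vs = vs2.span (\<Union>v\<in>set vs. (\<lambda>w. act w v) ` W)"

text \<open>For a subspace \<open>W\<close> this recursion says that the map from \<open>W\<^sup>m\<close> sending \<open>(w\<^sub>i)\<close> to the sum of the
\<open>act w\<^sub>i v\<^sub>i\<close> is injective; its image is \<open>tile_span W vs\<close>.\<close>

fun tiling :: "'b set \<Rightarrow> 'c list \<Rightarrow> bool" where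
  "tiling W [] \<longleftrightarrow> True"
| "tiling W (v # vs) \<longleftrightarrow> tiling W vs \<and> (\<forall>w\<in>W. act w v \<in> tile_span W vs \<longrightarrow> w = 0)"

lemma subspace_tile_span: "vs2.subspace (tile_span W vs)"
  unfolding tile_span_def by simp

lemma tile_span_Nil: "tile_span W [] = {0}"
  unfolding tile_span_def by simp

lemma tile_span_Cons:
  "tile_span W (v # vs) = vs2.span ((\<lambda>w. act w v) ` W \<union> tile_span W vs)"
  unfolding tile_span_def by (simp add: vs2.span_Un vs2.span_span)

lemma act_in_tile_span: "v \<in> set vs \<Longrightarrow> w \<in> W \<Longrightarrow> act w v \<in> tile_span W vs"
  unfolding tile_span_def by (intro vs2.span_base) auto

lemma tile_span_mono: "W1 \<subseteq> W \<Longrightarrow> tile_span W1 vs \<subseteq> tile_span W vs"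
  unfolding tile_span_def by (intro vs2.span_mono) auto

lemma fin_dim_tile_span:
  assumes "vs1.fin_dim W"
  shows "vs2.fin_dim (tile_span W vs)"
proof (induction vs)
  case Nil
  show ?case
    unfolding tile_span_Nil vs2.fin_dim_def by (rule exI[of _ "{}"]) simp
next
  case (Cons v vs)
  then show ?case
    unfolding tile_span_Cons using fin_dim_image[OF linear_left assms]
    by (intro vs2.fin_dim_span vs2.fin_dim_Un)
qed

text \<open>The count holds for every subspace \<open>W1\<close> of \<open>W\<close>. The case \<open>W1 = W\<close> measures how much of the space
is filled; the case of the elements of \<open>W\<close> which stay in \<open>W\<close> under multiplication by \<open>a\<close> measures how
much of it the intertwiner controls.\<close>

lemma dim_tile_span:
  assumes "tiling W vs" "W1 \<subseteq> W" "vs1.subspace W1" "vs1.fin_dim W1"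
  shows "vs2.dim (tile_span W1 vs) = length vs * vs1.dim W1"
  using assms(1)
proof (induction vs)
  case Nil
  then show ?case by (simp add: tile_span_Nil vs2.dim_zero_subspace)
next
  case (Cons v vs)
  let ?P = "(\<lambda>w. act w v) ` W1"
  have inj: "w = 0" if "w \<in> W1" "act w v \<in> tile_span W vs" for w
    using Cons.prems that assms(2) by auto
  have zero: "0 \<in> tile_span W vs"
    by (rule vs2.subspace_0[OF subspace_tile_span])
  have "?P \<inter> tile_span W1 vs \<subseteq> {0}"
  proof
    fix y assume y: "y \<in> ?P \<inter> tile_span W1 vs"
    then obtain w where w: "w \<in> W1" "y = act w v"
      by blast
    then have "w = 0"
      using inj y tile_span_mono[OF assms(2), of vs] by blast
    then show "y \<in> {0}"
      using w linear_0[OF linear_left] by simp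
  qed
  then have "vs2.dim (tile_span W1 (v # vs)) = vs2.dim ?P + vs2.dim (tile_span W1 vs)"
    unfolding tile_span_Cons
    by (intro vs2.dim_span_Un_disjoint linear_subspace_image[OF linear_left] assms
        subspace_tile_span fin_dim_image[OF linear_left] fin_dim_tile_span)
  moreover have "vs2.dim ?P = vs1.dim W1"
    using inj zero by (intro dim_image_inj[OF linear_left] assms) auto
  ultimately show ?case
    using Cons by simp
qed

lemma exists_tiling:
  assumes step: "\<And>vs. set vs \<subseteq> U \<Longrightarrow> tiling W vs \<Longrightarrow> real (length vs * vs1.dim W) < c
      \<Longrightarrow> \<exists>v\<in>U. \<forall>w\<in>W. act w v \<in> tile_span W vs \<longrightarrow> w = 0"
    and m: "\<And>i. i < m \<Longrightarrow> real (i * vs1.dim W) < c"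
  shows "\<exists>vs. length vs = m \<and> set vs \<subseteq> U \<and> tiling W vs"
  using m
proof (induction m)
  case 0
  show ?case by (rule exI[of _ "[]"]) simp
next
  case (Suc m)
  then obtain vs where vs: "length vs = m" "set vs \<subseteq> U" "tiling W vs"
    by auto
  moreover obtain v where "v \<in> U" "\<forall>w\<in>W. act w v \<in> tile_span W vs \<longrightarrow> w = 0"
    using step[OF vs(2,3)] Suc.prems[of m] vs(1) by auto
  ultimately show ?case
    by (intro exI[of _ "v # vs"]) auto
qed

text \<open>By \<open>dim_tile_span\<close>, the spanning family \<open>e\<close> of \<open>tile_span W vs\<close> has as many members as the
dimension, which forces it to be injective and independent.\<close>

lemma tiling_basis:
  assumes vs: "tiling W vs" and B: "finite B" "vs1.independent B" "vs1.span B = W"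
  defines "J \<equiv> {..<length vs} \<times> B"
  defines "e \<equiv> (\<lambda>(i, b). act b (vs ! i))"
  shows "inj_on e J \<and> vs2.independent (e ` J)"
proof -
  have W: "vs1.subspace W" "vs1.fin_dim W" "vs1.dim W = card B"
    using B vs1.dim_span_eq_card_independent[OF B(2)] unfolding vs1.fin_dim_def by auto
  have fJ: "finite J"
    unfolding J_def using B by simp
  have "tile_span W vs \<subseteq> vs2.span (e ` J)"
    unfolding tile_span_def
  proof (intro vs2.span_minimal vs2.subspace_span UN_least)
    fix v assume "v \<in> set vs"
    then obtain i where i: "i < length vs" "v = vs ! i"
      by (auto simp: in_set_conv_nth)
    have "(\<lambda>w. act w v) ` W = vs2.span ((\<lambda>w. act w v) ` B)"
      using linear_span_image[OF linear_left] B(3) by blast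
    also have "\<dots> \<subseteq> vs2.span (e ` J)"
      using i unfolding J_def e_def by (intro vs2.span_mono) force
    finally show "(\<lambda>w. act w v) ` W \<subseteq> vs2.span (e ` J)" .
  qed
  moreover have "e ` J \<subseteq> tile_span W vs"
    using B(3) vs1.span_superset[of B] unfolding J_def e_def
    by (auto intro!: act_in_tile_span)
  ultimately have sp: "vs2.span (e ` J) = tile_span W vs"
    using vs2.span_minimal[OF _ subspace_tile_span] by blast
  have d: "vs2.dim (e ` J) = card J"
    using dim_tile_span[OF vs order_refl W(1,2)] W(3) sp vs2.dim_span[of "e ` J"]
    by (simp add: J_def card_cartesian_product)
  obtain C where C: "C \<subseteq> e ` J" "vs2.independent C" "card C = vs2.dim (e ` J)"
    using vs2.basis_exists by metis
  have "card (e ` J) \<le> card C"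
    using C d card_image_le[OF fJ, of e] by simp
  then have "C = e ` J"
    using C fJ by (intro card_seteq) auto
  then show ?thesis
    using C d fJ by (auto intro: eq_card_imp_inj_on)
qed

end

text \<open>The two tilings consist of equally many copies of the same \<open>W\<close>, so their bases are indexed by the
same set, and matching them is a bijection of independent sets.\<close>

lemma (in linear_space_pair) tiling_isomorphism:
  assumes "linear_action s1 s2 f" "linear_action s1 s2 g"
    and W: "vs1.subspace W" "vs1.fin_dim W"
    and F: "vs2.subspace F" "vs2.fin_dim F" "\<And>w v. f w v \<in> F" "\<And>w v. g w v \<in> F"
    and vs: "linear_action.tiling s2 f W vs" "linear_action.tiling s2 g W us" "length us = length vs"
  obtains h h' where "Vector_Spaces.linear s2 s2 h" "Vector_Spaces.linear s2 s2 h'"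
    "h ` F \<subseteq> F" "h' ` F \<subseteq> F"
    "\<And>x. x \<in> F \<Longrightarrow> h (h' x) = x" "\<And>x. x \<in> F \<Longrightarrow> h' (h x) = x"
    "\<And>i w. i < length vs \<Longrightarrow> w \<in> W \<Longrightarrow> h (g w (us ! i)) = f w (vs ! i)"
proof -
  interpret f: linear_action s1 s2 f by fact
  interpret g: linear_action s1 s2 g by fact
  obtain B where B: "finite B" "vs1.independent B" "vs1.span B = W"
    using vs1.fin_dim_basis[OF W(2,1)] by blast
  define J where "J = {..<length vs} \<times> B"
  define e where "e = (\<lambda>(i, b). f b (vs ! i))"
  define e' where "e' = (\<lambda>(i, b). g b (us ! i))"
  have e: "inj_on e J" "vs2.independent (e ` J)"
    using f.tiling_basis[OF vs(1) B] unfolding J_def e_def by auto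
  have e': "inj_on e' J" "vs2.independent (e' ` J)"
    using g.tiling_basis[OF vs(2) B] unfolding J_def e'_def vs(3) by auto
  have sub: "e ` J \<subseteq> F" "e' ` J \<subseteq> F"
    using F unfolding e_def e'_def by auto
  have bij: "bij_betw (e \<circ> inv_into J e') (e' ` J) (e ` J)"
    using e(1) e'(1) by (intro bij_betw_trans[OF bij_betw_inv_into]) (auto simp: bij_betw_def)
  obtain h h' where h: "Vector_Spaces.linear s2 s2 h" "Vector_Spaces.linear s2 s2 h'"
    "h ` F \<subseteq> F" "h' ` F \<subseteq> F"
    "\<And>x. x \<in> F \<Longrightarrow> h (h' x) = x" "\<And>x. x \<in> F \<Longrightarrow> h' (h x) = x"
    "\<And>x. x \<in> e' ` J \<Longrightarrow> h x = (e \<circ> inv_into J e') x"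
    by (rule vs2.extend_bijection_to_automorphism[OF F(1,2) sub(2) e'(2) sub(1) e(2) bij]) (rule that)
  have hk: "h (g w (us ! i)) = f w (vs ! i)" if i: "i < length vs" and w: "w \<in> W" for i w
  proof -
    have "(h \<circ> (\<lambda>w. g w (us ! i))) w = f w (vs ! i)"
    proof (rule linear_eq_on)
      show "Vector_Spaces.linear s1 s2 (h \<circ> (\<lambda>w. g w (us ! i)))"
        using Vector_Spaces.linear_compose[OF g.linear_left h(1)] .
      show "Vector_Spaces.linear s1 s2 (\<lambda>w. f w (vs ! i))"
        by (rule f.linear_left)
      show "w \<in> vs1.span B"
        using w B by simp
      fix b assume b: "b \<in> B"
      then have J: "(i, b) \<in> J"
        using i unfolding J_def by simp
      then have "h (e' (i, b)) = e (i, b)"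
        using h(7) e'(1) by simp
      then show "(h \<circ> (\<lambda>w. g w (us ! i))) b = f b (vs ! i)"
        unfolding e_def e'_def by simp
    qed
    then show ?thesis by simp
  qed
  show ?thesis
    by (rule that[OF h(1-6) hk])
qed

section \<open>Matrices as operators on finitely supported sequences\<close>

definition fscale :: "'k::field \<Rightarrow> (nat \<Rightarrow> 'k) \<Rightarrow> nat \<Rightarrow> 'k" where
  "fscale c f = (\<lambda>i. c * f i)"

interpretation fs: linear_space "fscale :: 'k::field \<Rightarrow> _"
  by unfold_locales (auto simp: fscale_def fun_eq_iff algebra_simps)

interpretation fs2: linear_space_pair "fscale :: 'k::field \<Rightarrow> _" "fscale :: 'k \<Rightarrow> _"
  by unfold_locales

lemma linear_fscale_iff:
  fixes s :: "'k::field \<Rightarrow> 'a::ab_group_add \<Rightarrow> 'a"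
  assumes "vector_space s"
  shows "Vector_Spaces.linear s fscale h \<longleftrightarrow>
    (\<forall>x y i. h (x + y) i = h x i + h y i) \<and> (\<forall>c x i. h (s c x) i = c * h x i)"
proof -
  have "vector_space (fscale :: 'k \<Rightarrow> _)"
    by (rule fs.vector_space_axioms)
  with assms show ?thesis
    by (simp add: Vector_Spaces.linear_iff fun_eq_iff fscale_def)
qed

definition coord_space :: "nat \<Rightarrow> (nat \<Rightarrow> 'k::field) set" where
  "coord_space n = {f. \<forall>i\<ge>n. f i = 0}"

definition coord_unit :: "nat \<Rightarrow> nat \<Rightarrow> 'k::field" where
  "coord_unit i = (\<lambda>j. if j = i then 1 else 0)"

lemma sum_fun_apply: "(\<Sum>x\<in>A. h x) i = (\<Sum>x\<in>A. h x i)" for h :: "'a \<Rightarrow> nat \<Rightarrow> 'k::field"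
  by (induction A rule: infinite_finite_induct) auto

lemma subspace_coord_space: "fs.subspace (coord_space n)"
  by (rule fs.subspaceI) (auto simp: coord_space_def fscale_def)

lemma coord_expansion:
  assumes "f \<in> coord_space n"
  shows "f = (\<Sum>i<n. fscale (f i) (coord_unit i))"
proof
  fix j
  show "f j = (\<Sum>i<n. fscale (f i) (coord_unit i)) j"
    using assms by (simp add: sum_fun_apply fscale_def coord_unit_def coord_space_def
        if_distrib[of "(*) _"] cong: if_cong)
qed

lemma inj_coord_unit: "inj (coord_unit :: nat \<Rightarrow> nat \<Rightarrow> 'k::field)"
  by (rule injI) (metis coord_unit_def one_neq_zero)

lemma independent_coord_units:
  "fs.independent (coord_unit ` {..<n} :: (nat \<Rightarrow> 'k::field) set)"
proof (rule fs.independent_if_scalars_zero)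
  fix u :: "(nat \<Rightarrow> 'k) \<Rightarrow> 'k" and x :: "nat \<Rightarrow> 'k"
  assume "(\<Sum>x\<in>coord_unit ` {..<n}. fscale (u x) x) = 0" "x \<in> coord_unit ` {..<n}"
  then obtain j where j: "j < n" "x = coord_unit j"
    and "(\<Sum>i<n. fscale (u (coord_unit i)) (coord_unit i)) = 0"
    by (subst (asm) sum.reindex) (auto intro: inj_on_subset[OF inj_coord_unit])
  then have "(\<Sum>i<n. fscale (u (coord_unit i)) (coord_unit i)) j = 0"
    by simp
  then show "u x = 0"
    using j by (simp add: sum_fun_apply fscale_def coord_unit_def
        if_distrib[of "(*) _"] cong: if_cong)
qed simp

lemma span_coord_units:
  "fs.span (coord_unit ` {..<n}) = (coord_space n :: (nat \<Rightarrow> 'k::field) set)"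
proof
  show "fs.span (coord_unit ` {..<n}) \<subseteq> (coord_space n :: (nat \<Rightarrow> 'k) set)"
    by (intro fs.span_minimal subspace_coord_space) (auto simp: coord_unit_def coord_space_def)
  show "(coord_space n :: (nat \<Rightarrow> 'k) set) \<subseteq> fs.span (coord_unit ` {..<n})"
  proof
    fix f :: "nat \<Rightarrow> 'k"
    assume f: "f \<in> coord_space n"
    have "(\<Sum>i<n. fscale (f i) (coord_unit i)) \<in> fs.span (coord_unit ` {..<n})"
      by (rule fs.span_sum, rule fs.span_scale, rule fs.span_base) simp
    then show "f \<in> fs.span (coord_unit ` {..<n})"
      using coord_expansion[OF f] by simp
  qed
qed

lemma fin_dim_coord_space: "fs.fin_dim (coord_space n)"
  unfolding fs.fin_dim_def span_coord_units[symmetric] by (rule exI[of _ "coord_unit ` {..<n}"]) auto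

lemma dim_coord_space: "fs.dim (coord_space n :: (nat \<Rightarrow> 'k::field) set) = n"
proof -
  have "fs.dim (coord_space n :: (nat \<Rightarrow> 'k) set) = card (coord_unit ` {..<n} :: (nat \<Rightarrow> 'k) set)"
    using fs.dim_span_eq_card_independent[OF independent_coord_units] span_coord_units by metis
  then show ?thesis
    by (simp add: card_image inj_on_subset[OF inj_coord_unit])
qed

definition mat_op :: "nat \<Rightarrow> 'k::field mat \<Rightarrow> (nat \<Rightarrow> 'k) \<Rightarrow> nat \<Rightarrow> 'k" where
  "mat_op n X f = (\<lambda>i. if i < n then \<Sum>j<n. X $$ (i, j) * f j else 0)"

definition mat_of_op :: "nat \<Rightarrow> ((nat \<Rightarrow> 'k::field) \<Rightarrow> nat \<Rightarrow> 'k) \<Rightarrow> 'k mat" where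
  "mat_of_op n h = mat n n (\<lambda>(i, j). h (coord_unit j) i)"

lemma linear_mat_op: "Vector_Spaces.linear fscale fscale (mat_op n X)"
  by (simp add: linear_fscale_iff fs.vector_space_axioms mat_op_def fscale_def
      algebra_simps sum.distrib sum_distrib_left)

lemma mat_op_in: "mat_op n X f \<in> coord_space n"
  by (simp add: mat_op_def coord_space_def)

lemma mat_op_mult:
  assumes "X \<in> carrier_mat n n" "Y \<in> carrier_mat n n"
  shows "mat_op n (X * Y) f = mat_op n X (mat_op n Y f)"
proof
  fix i
  show "mat_op n (X * Y) f i = mat_op n X (mat_op n Y f) i"
  proof (cases "i < n")
    case True
    have "mat_op n (X * Y) f i = (\<Sum>j<n. (\<Sum>l<n. X $$ (i, l) * Y $$ (l, j)) * f j)"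
      using True assms by (simp add: mat_op_def scalar_prod_def lessThan_atLeast0)
    also have "\<dots> = (\<Sum>l<n. \<Sum>j<n. X $$ (i, l) * Y $$ (l, j) * f j)"
      by (subst sum.swap) (simp add: sum_distrib_right)
    also have "\<dots> = mat_op n X (mat_op n Y f) i"
      using True by (simp add: mat_op_def sum_distrib_left mult.assoc)
    finally show ?thesis .
  qed (simp add: mat_op_def)
qed

lemma mat_op_add:
  assumes "X \<in> carrier_mat n n" "Y \<in> carrier_mat n n"
  shows "mat_op n (X + Y) f = mat_op n X f + mat_op n Y f"
  using assms by (auto simp: mat_op_def fun_eq_iff sum.distrib algebra_simps)

lemma mat_op_diff:
  assumes "X \<in> carrier_mat n n" "Y \<in> carrier_mat n n"
  shows "mat_op n (X - Y) f = mat_op n X f - mat_op n Y f"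
  using assms by (auto simp: mat_op_def fun_eq_iff sum_subtractf algebra_simps)

lemma mat_op_smult:
  assumes "X \<in> carrier_mat n n"
  shows "mat_op n (c \<cdot>\<^sub>m X) f = fscale c (mat_op n X f)"
  using assms by (auto simp: mat_op_def fun_eq_iff fscale_def sum_distrib_left algebra_simps)

lemma mat_of_op_carrier: "mat_of_op n h \<in> carrier_mat n n"
  by (simp add: mat_of_op_def)

lemma mat_op_coord_unit: "i < n \<Longrightarrow> j < n \<Longrightarrow> mat_op n X (coord_unit j) i = X $$ (i, j)"
  by (simp add: mat_op_def coord_unit_def if_distrib[of "(*) _"] cong: if_cong)

lemma mat_eqI_op:
  assumes "X \<in> carrier_mat n n" "Y \<in> carrier_mat n n"
    and "\<And>f. f \<in> coord_space n \<Longrightarrow> mat_op n X f = mat_op n Y f"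
  shows "X = Y"
proof (rule eq_matI)
  fix i j assume "i < dim_row Y" "j < dim_col Y"
  then have ij: "i < n" "j < n"
    using assms by auto
  then have "coord_unit j \<in> coord_space n"
    by (auto simp: coord_unit_def coord_space_def)
  then show "X $$ (i, j) = Y $$ (i, j)"
    using assms(3) mat_op_coord_unit ij by metis
qed (use assms in auto)

lemma mat_op_mat_of_op:
  assumes h: "Vector_Spaces.linear fscale fscale h" "h ` coord_space n \<subseteq> coord_space n"
    and f: "f \<in> coord_space n"
  shows "mat_op n (mat_of_op n h) f = h f"
proof
  fix i
  have "h f = h (\<Sum>j<n. fscale (f j) (coord_unit j))"
    using coord_expansion[OF f] by simp
  also have "\<dots> = (\<Sum>j<n. fscale (f j) (h (coord_unit j)))"
    by (simp add: fs2.linear_sum[OF h(1)] fs2.linear_scale[OF h(1)])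
  finally have "h f i = (\<Sum>j<n. f j * h (coord_unit j) i)"
    by (simp add: sum_fun_apply fscale_def)
  moreover have "h f \<in> coord_space n"
    using h(2) f by blast
  then have "h f i = 0" if "\<not> i < n"
    using that by (simp add: coord_space_def)
  ultimately show "mat_op n (mat_of_op n h) f i = h f i"
    by (simp add: mat_op_def mat_of_op_def mult.commute)
qed

lemma mat_op_one: "f \<in> coord_space n \<Longrightarrow> mat_op n (1\<^sub>m n) f = f"
proof
  fix i assume f: "f \<in> coord_space n"
  have "(\<Sum>j<n. 1\<^sub>m n $$ (i, j) * f j) = f i" if "i < n"
  proof -
    have "(\<Sum>j<n. 1\<^sub>m n $$ (i, j) * f j) = (\<Sum>j<n. if j = i then f j else 0)"
      using that by (intro sum.cong) auto
    then show ?thesis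
      using that by simp
  qed
  then show "mat_op n (1\<^sub>m n) f i = f i"
    using f by (auto simp: mat_op_def coord_space_def)
qed

section \<open>Comparison of dimensions\<close>

definition vec_seq :: "nat \<Rightarrow> 'k::field vec \<Rightarrow> nat \<Rightarrow> 'k" where
  "vec_seq n v = (\<lambda>i. if i < n then v $ i else 0)"

lemma vec_seq_in: "vec_seq n v \<in> coord_space n"
  by (simp add: vec_seq_def coord_space_def)

lemma vec_seq_vec: "f \<in> coord_space n \<Longrightarrow> vec_seq n (vec n f) = f"
  by (auto simp: vec_seq_def coord_space_def fun_eq_iff)

lemma vec_vec_seq: "v \<in> carrier_vec n \<Longrightarrow> vec n (vec_seq n v) = v"
  by (auto simp: vec_seq_def)

lemma vec_seq_zero: "vec_seq n (0\<^sub>v n) = 0"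
  by (simp add: vec_seq_def fun_eq_iff)

lemma vec_seq_mult_mat_vec:
  assumes "X \<in> carrier_mat n n" "v \<in> carrier_vec n"
  shows "vec_seq n (X *\<^sub>v v) = mat_op n X (vec_seq n v)"
  using assms by (auto simp: vec_seq_def mat_op_def fun_eq_iff scalar_prod_def lessThan_atLeast0)

context
  fixes n :: nat and U :: "'k::field vec set"
  assumes U: "VectorSpace.subspace class_ring U (module_vec TYPE('k) n)"
begin

interpretation vec_space "TYPE('k)" n .

lemma subspace_carrier: "U \<subseteq> carrier_vec n"
  using U submodule.subset[OF is_module[OF U]] by simp

lemma subspace_closed:
  shows "u \<in> U \<Longrightarrow> v \<in> U \<Longrightarrow> u + v \<in> U" "0\<^sub>v n \<in> U" "u \<in> U \<Longrightarrow> c \<cdot>\<^sub>v u \<in> U"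
  using submodule.m_closed[OF is_module[OF U]] submodule.zero_closed[OF is_module[OF U]]
    submodule.smult_closed[OF is_module[OF U]] by auto

lemma subspace_vec_seq: "fs.subspace (vec_seq n ` U)"
proof (rule fs.subspaceI)
  show "0 \<in> vec_seq n ` U"
    using subspace_closed(2) by (force simp: vec_seq_def fun_eq_iff image_iff)
  fix x y c assume "x \<in> vec_seq n ` U"
  then obtain u where u: "u \<in> U" "x = vec_seq n u"
    by blast
  have "fscale c x = vec_seq n (c \<cdot>\<^sub>v u)"
    using u subspace_carrier by (auto simp: vec_seq_def fun_eq_iff fscale_def)
  then show "fscale c x \<in> vec_seq n ` U"
    using subspace_closed(3) u by blast
  assume "y \<in> vec_seq n ` U"
  then obtain v where v: "v \<in> U" "y = vec_seq n v"
    by blast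
  have "x + y = vec_seq n (u + v)"
    using u v subspace_carrier by (auto simp: vec_seq_def fun_eq_iff)
  then show "x + y \<in> vec_seq n ` U"
    using subspace_closed(1) u v by blast
qed

text \<open>A basis of the image, taken back to vectors of length \<open>n\<close>, is a basis of \<open>U\<close>.\<close>

lemma dim_vec_seq:
  "vectorspace.dim class_ring (module_vec TYPE('k) n\<lparr>carrier := U\<rparr>) = fs.dim (vec_seq n ` U)"
proof -
  have fin: "fs.fin_dim (vec_seq n ` U)"
    using vec_seq_in by (intro fs.fin_dim_subset[OF _ fin_dim_coord_space]) blast
  obtain C where C: "finite C" "fs.independent C" "fs.span C = vec_seq n ` U"
    "card C = fs.dim (vec_seq n ` U)"
    using fs.fin_dim_basis[OF fin subspace_vec_seq] by blast
  have C_sub: "C \<subseteq> vec_seq n ` U"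
    using C(3) fs.span_superset by blast
  then have C_coord: "C \<subseteq> coord_space n"
    using vec_seq_in by blast
  have inj: "inj_on (vec n) C"
    using C_coord vec_seq_vec by (intro inj_on_inverseI[of _ "vec_seq n"]) blast
  define B where "B = vec n ` C"
  have "vec n f \<in> U" if f: "f \<in> C" for f
  proof -
    obtain u where u: "u \<in> U" "f = vec_seq n u"
      using C_sub f by blast
    then have "vec n f = u"
      using vec_vec_seq[of u n] subspace_carrier by blast
    then show ?thesis
      using u by simp
  qed
  then have B: "finite B" "B \<subseteq> U" "card B = card C"
    unfolding B_def using C(1) inj by (auto simp: card_image)
  have Bc: "B \<subseteq> carrier_vec n"
    using B(2) subspace_carrier by blast
  have lc: "vec_seq n (lincomb a B) = (\<Sum>f\<in>C. fscale (a (vec n f)) f)" for a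
  proof
    fix i
    show "vec_seq n (lincomb a B) i = (\<Sum>f\<in>C. fscale (a (vec n f)) f) i"
    proof (cases "i < n")
      case True
      have "lincomb a B $ i = (\<Sum>x\<in>B. a x * x $ i)"
        using lincomb_index[OF True Bc] .
      also have "\<dots> = (\<Sum>f\<in>C. a (vec n f) * vec n f $ i)"
        unfolding B_def by (simp add: sum.reindex[OF inj])
      finally show ?thesis
        using True by (simp add: vec_seq_def sum_fun_apply fscale_def)
    next
      case False
      then have "f i = 0" if "f \<in> C" for f
        using that C_coord by (auto simp: coord_space_def)
      then show ?thesis
        using False by (simp add: vec_seq_def sum_fun_apply fscale_def)
    qed
  qed
  have indep: "lin_indpt B"
  proof (rule finite_lin_indpt2[OF B(1)])
    show "B \<subseteq> carrier_vec n"
      by (rule Bc)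
    fix a :: "'k vec \<Rightarrow> 'k"
    assume "lincomb a B = 0\<^sub>v n"
    then have "(\<Sum>f\<in>C. fscale (a (vec n f)) f) = 0"
      using lc[of a] by (simp add: vec_seq_zero)
    then have "a (vec n f) = 0" if "f \<in> C" for f
      using fs.independentD[OF C(2,1) order_refl, of "\<lambda>f. a (vec n f)"] that by blast
    then show "\<forall>v\<in>B. a v = 0"
      unfolding B_def by auto
  qed
  have "span B = U"
  proof
    show "span B \<subseteq> U"
      using span_is_subset[OF B(2)] is_module[OF U] by blast
    show "U \<subseteq> span B"
    proof
      fix u assume u: "u \<in> U"
      then have "vec_seq n u \<in> fs.span C"
        using C(3) by blast
      then obtain c where c: "vec_seq n u = (\<Sum>f\<in>C. fscale (c f) f)"
        unfolding fs.span_finite[OF C(1)] by blast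
      define a where "a v = c (vec_seq n v)" for v
      have "a (vec n f) = c f" if "f \<in> C" for f
        using vec_seq_vec[of f n] C_coord that unfolding a_def by (metis subsetD)
      then have "(\<Sum>f\<in>C. fscale (a (vec n f)) f) = (\<Sum>f\<in>C. fscale (c f) f)"
        by (intro sum.cong) auto
      then have "vec_seq n (lincomb a B) = vec_seq n u"
        using lc c by simp
      moreover have "lincomb a B \<in> carrier_vec n"
        using lincomb_dim[OF B(1) Bc] carrier_vecI by blast
      moreover have "u \<in> carrier_vec n"
        using u subspace_carrier by blast
      ultimately have "u = lincomb a B"
        using vec_vec_seq by metis
      then show "u \<in> span B"
        using finite_span[OF B(1)] Bc by auto
    qed
  qed
  have vsU: "vectorspace class_ring (vs U)"
    using subspace_is_vs[OF U] .
  have "vectorspace.basis class_ring (vs U) B"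
    unfolding vectorspace.basis_def[OF vsU]
    using span_li_not_depend[OF B(2) is_module[OF U]] \<open>span B = U\<close> indep B(2) by simp
  then show ?thesis
    using vectorspace.dim_basis[OF vsU B(1)] B(3) C(4) by simp
qed

end

lemma subspace_vec_seq_preimage:
  fixes U :: "(nat \<Rightarrow> 'k::field) set"
  assumes U: "fs.subspace U"
  shows "VectorSpace.subspace class_ring {v \<in> carrier_vec n. vec_seq n v \<in> U} (module_vec TYPE('k) n)"
proof -
  define U' where "U' = {v \<in> carrier_vec n. vec_seq n v \<in> U}"
  interpret vec_space "TYPE('k)" n .
  have "VectorSpace.subspace class_ring U' V"
  proof (rule VectorSpace.subspace.intro[OF vectorspace_axioms], rule submodule.intro)
    show "Module.module class_ring V"
      by (rule module_axioms)
    show "U' \<subseteq> carrier V"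
      unfolding U'_def by auto
    show "\<zero>\<^bsub>V\<^esub> \<in> U'"
      unfolding U'_def using fs.subspace_0[OF U] by (simp add: vec_seq_zero)
    show "v \<oplus>\<^bsub>V\<^esub> w \<in> U'" if "v \<in> U'" "w \<in> U'" for v w
    proof -
      have "vec_seq n (v + w) = vec_seq n v + vec_seq n w"
        using that unfolding U'_def by (auto simp: vec_seq_def fun_eq_iff)
      then show ?thesis
        using that fs.subspace_add[OF U] unfolding U'_def by auto
    qed
    show "x \<odot>\<^bsub>V\<^esub> v \<in> U'" if "v \<in> U'" for x v
    proof -
      have "vec_seq n (x \<cdot>\<^sub>v v) = fscale x (vec_seq n v)"
        using that unfolding U'_def by (auto simp: vec_seq_def fun_eq_iff fscale_def)
      then show ?thesis
        using that fs.subspace_scale[OF U] unfolding U'_def by auto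
    qed
  qed
  then show ?thesis
    unfolding U'_def .
qed

lemma image_vec_seq_preimage:
  assumes "U \<subseteq> coord_space n"
  shows "vec_seq n ` {v \<in> carrier_vec n. vec_seq n v \<in> U} = U"
proof (intro subset_antisym subsetI)
  fix f assume f: "f \<in> U"
  then have "f = vec_seq n (vec n f)"
    using assms vec_seq_vec[of f n] by auto
  then show "f \<in> vec_seq n ` {v \<in> carrier_vec n. vec_seq n v \<in> U}"
    using f by (metis (mono_tags, lifting) imageI mem_Collect_eq vec_carrier)
qed auto

lemma rank_eq_dim_range:
  fixes X :: "'k::field mat"
  assumes X: "X \<in> carrier_mat n n"
  shows "vec_space.rank n X = fs.dim (mat_op n X ` coord_space n)"
proof -
  interpret vec_space "TYPE('k)" n .
  have cols: "set (cols X) \<subseteq> carrier_vec n"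
    using X cols_dim by blast
  have "rank X = fs.dim (vec_seq n ` span (set (cols X)))"
    unfolding rank_def using dim_vec_seq[OF span_is_subspace] cols by simp
  also have "span (set (cols X)) = {y \<in> carrier_vec n. \<exists>x\<in>carrier_vec n. X *\<^sub>v x = y}"
    using col_space_eq[of X] X unfolding col_space_def by simp
  also have "vec_seq n ` \<dots> = mat_op n X ` coord_space n"
  proof (intro subset_antisym subsetI)
    fix f assume "f \<in> vec_seq n ` {y \<in> carrier_vec n. \<exists>x\<in>carrier_vec n. X *\<^sub>v x = y}"
    then obtain x where "x \<in> carrier_vec n" "f = vec_seq n (X *\<^sub>v x)"
      by blast
    then show "f \<in> mat_op n X ` coord_space n"
      using vec_seq_mult_mat_vec[OF X] vec_seq_in by blast
  next
    fix f assume "f \<in> mat_op n X ` coord_space n"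
    then obtain g where g: "g \<in> coord_space n" "f = mat_op n X g"
      by blast
    then have "f = vec_seq n (X *\<^sub>v vec n g)"
      using vec_seq_mult_mat_vec[OF X, of "vec n g"] by (simp add: vec_seq_vec)
    moreover have "X *\<^sub>v vec n g \<in> carrier_vec n"
      using X by simp
    ultimately show "f \<in> vec_seq n ` {y \<in> carrier_vec n. \<exists>x\<in>carrier_vec n. X *\<^sub>v x = y}"
      by (metis (mono_tags, lifting) imageI mem_Collect_eq vec_carrier)
  qed
  finally show ?thesis .
qed

section \<open>The metric ultraproduct\<close>

lemma rank_mult_le:
  fixes X Y :: "'k::field mat"
  assumes "X \<in> carrier_mat n n" "Y \<in> carrier_mat n n"
  shows "vec_space.rank n (X * Y) \<le> vec_space.rank n X"
    and "vec_space.rank n (X * Y) \<le> vec_space.rank n Y"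
proof -
  let ?F = "coord_space n :: (nat \<Rightarrow> 'k) set"
  have fd: "fs.fin_dim (mat_op n Z ` ?F)" for Z :: "'k mat"
    by (rule fs.fin_dim_subset[OF _ fin_dim_coord_space[of n]]) (auto simp: mat_op_in)
  have eq: "vec_space.rank n (X * Y) = fs.dim (mat_op n X ` mat_op n Y ` ?F)"
    using assms by (simp add: rank_eq_dim_range image_comp comp_def mat_op_mult)
  have "fs.dim (mat_op n X ` mat_op n Y ` ?F) \<le> fs.dim (mat_op n X ` ?F)"
    by (intro fs.fin_dim_dim_mono fd image_mono) (auto simp: mat_op_in)
  then show "vec_space.rank n (X * Y) \<le> vec_space.rank n X"
    using eq assms by (simp add: rank_eq_dim_range)
  have "fs.dim (mat_op n X ` mat_op n Y ` ?F) \<le> fs.dim (mat_op n Y ` ?F)"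
    by (intro fs2.dim_image_le linear_mat_op fd fs2.linear_subspace_image subspace_coord_space)
  then show "vec_space.rank n (X * Y) \<le> vec_space.rank n Y"
    using eq assms by (simp add: rank_eq_dim_range)
qed

lemma rank_le_codim_kernel:
  fixes X :: "'k::field mat"
  assumes X: "X \<in> carrier_mat n n" and Z: "fs.subspace Z" "Z \<subseteq> coord_space n"
    and zero: "\<And>f. f \<in> Z \<Longrightarrow> mat_op n X f = 0"
  shows "vec_space.rank n X + fs.dim Z \<le> n"
proof -
  let ?F = "coord_space n :: (nat \<Rightarrow> 'k) set"
  have "fs.dim ?F = fs.dim (mat_op n X ` ?F) + fs.dim {f \<in> ?F. mat_op n X f = 0}"
    by (intro fs2.rank_nullity linear_mat_op subspace_coord_space fin_dim_coord_space)
  moreover have "fs.dim Z \<le> fs.dim {f \<in> ?F. mat_op n X f = 0}"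
    using Z zero by (intro fs.fin_dim_dim_mono fs.fin_dim_subset[OF _ fin_dim_coord_space]) auto
  ultimately show ?thesis
    using X by (simp add: rank_eq_dim_range dim_coord_space)
qed

lemma normalized_rank_nonneg: "normalized_rank n X \<ge> 0"
  by (simp add: normalized_rank_def)

lemma normalized_rank_mult_le:
  assumes "X \<in> carrier_mat n n" "Y \<in> carrier_mat n n"
  shows "normalized_rank n (X * Y) \<le> normalized_rank n X"
    and "normalized_rank n (X * Y) \<le> normalized_rank n Y"
  using rank_mult_le[OF assms] by (auto simp: normalized_rank_def divide_right_mono)

lemma normalized_rank_add_le:
  assumes "X \<in> carrier_mat n n" "Y \<in> carrier_mat n n"
  shows "normalized_rank n (X + Y) \<le> normalized_rank n X + normalized_rank n Y"
proof -
  have "vec_space.rank n (X + Y) \<le> vec_space.rank n X + vec_space.rank n Y"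
    using assms by (rule vec_space.rank_subadditive)
  then show ?thesis
    by (simp add: normalized_rank_def add_divide_distrib[symmetric] divide_right_mono
        flip: of_nat_add)
qed

lemma normalized_rank_zero: "normalized_rank n (0\<^sub>m n n :: 'k::field mat) = 0"
proof -
  have "vec_space.rank n (0\<^sub>m n n :: 'k mat) + fs.dim (coord_space n :: (nat \<Rightarrow> 'k) set) \<le> n"
    by (rule rank_le_codim_kernel) (auto simp: subspace_coord_space mat_op_def fun_eq_iff)
  then show ?thesis
    by (simp add: dim_coord_space normalized_rank_def)
qed

lemma normalized_rank_uminus:
  assumes X: "X \<in> carrier_mat n n"
  shows "normalized_rank n (- X) = normalized_rank n X"
proof -
  have le: "normalized_rank n (- Y) \<le> normalized_rank n Y" if Y: "Y \<in> carrier_mat n n"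
    for Y :: "'a mat"
  proof -
    have "- Y = - (1\<^sub>m n) * Y"
      using Y by (simp add: uminus_mult_left_mat)
    then show ?thesis
      using normalized_rank_mult_le(2)[of "- (1\<^sub>m n)" n Y] Y by simp
  qed
  show ?thesis
    using le[OF X] le[of "- X"] X by simp
qed

lemma mat_seq_ring_simps:
  "carrier (mat_seq_ring n) = {x. \<forall>k. x k \<in> carrier_mat (n k) (n k)}"
  "x \<otimes>\<^bsub>mat_seq_ring n\<^esub> y = (\<lambda>k. x k * y k)"
  "x \<oplus>\<^bsub>mat_seq_ring n\<^esub> y = (\<lambda>k. x k + y k)"
  "\<one>\<^bsub>mat_seq_ring n\<^esub> = (\<lambda>k. 1\<^sub>m (n k))"
  "\<zero>\<^bsub>mat_seq_ring n\<^esub> = (\<lambda>k. 0\<^sub>m (n k) (n k))"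
  by (simp_all add: mat_seq_ring_def)

lemma ring_mat_seq_ring: "Ring.ring (mat_seq_ring n :: (nat \<Rightarrow> 'k::field mat) ring)"
proof (rule ringI)
  show "abelian_group (mat_seq_ring n :: (nat \<Rightarrow> 'k mat) ring)"
  proof (rule abelian_groupI)
    fix x :: "nat \<Rightarrow> 'k mat"
    assume "x \<in> carrier (mat_seq_ring n)"
    then show "\<exists>y\<in>carrier (mat_seq_ring n). y \<oplus>\<^bsub>mat_seq_ring n\<^esub> x = \<zero>\<^bsub>mat_seq_ring n\<^esub>"
      by (intro bexI[of _ "\<lambda>k. - x k"])
        (auto simp: mat_seq_ring_simps fun_eq_iff uminus_l_inv_mat)
  qed (auto simp: mat_seq_ring_simps fun_eq_iff intro!: assoc_add_mat[of _ "n k" "n k" for k]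
      comm_add_mat[of _ "n k" "n k" for k])
  show "Group.monoid (mat_seq_ring n :: (nat \<Rightarrow> 'k mat) ring)"
    by (rule monoidI) (auto simp: mat_seq_ring_simps fun_eq_iff intro!: mult_carrier_mat[of _ "n k" "n k" for k]
        assoc_mult_mat[of _ "n k" "n k" _ "n k" _ "n k" for k]
        left_mult_one_mat[of _ "n k" "n k" for k] right_mult_one_mat[of _ "n k" "n k" for k])
qed (auto simp: mat_seq_ring_simps fun_eq_iff intro!: add_mult_distrib_mat[of _ "n k" "n k" for k]
    mult_add_distrib_mat[of _ "n k" "n k" for k])

lemma mat_seq_ring_uminus:
  fixes x :: "nat \<Rightarrow> 'k::field mat"
  assumes "x \<in> carrier (mat_seq_ring n)"
  shows "\<ominus>\<^bsub>mat_seq_ring n\<^esub> x = (\<lambda>k. - x k)"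
proof -
  interpret Ring.ring "mat_seq_ring n :: (nat \<Rightarrow> 'k mat) ring"
    by (rule ring_mat_seq_ring)
  show ?thesis
    using assms by (intro minus_equality) (auto simp: mat_seq_ring_simps fun_eq_iff uminus_l_inv_mat)
qed

lemma tendsto_zero_squeeze:
  fixes f g :: "nat \<Rightarrow> real"
  assumes "(g \<longlongrightarrow> 0) \<omega>" "\<And>k. 0 \<le> f k" "\<And>k. f k \<le> g k"
  shows "(f \<longlongrightarrow> 0) \<omega>"
  by (rule tendsto_sandwich[OF _ _ tendsto_const assms(1)]) (auto simp: assms)

lemma ideal_null_ideal: "ideal (null_ideal \<omega> n) (mat_seq_ring n :: (nat \<Rightarrow> 'k::field mat) ring)"
proof -
  let ?R = "mat_seq_ring n :: (nat \<Rightarrow> 'k mat) ring"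
  let ?I = "null_ideal \<omega> n :: (nat \<Rightarrow> 'k mat) set"
  interpret Ring.ring ?R
    by (rule ring_mat_seq_ring)
  show ?thesis
  proof (rule idealI)
    show "subgroup ?I (add_monoid ?R)"
    proof (rule add.subgroupI)
      show "?I \<subseteq> carrier ?R"
        by (auto simp: null_ideal_def)
      have "\<zero>\<^bsub>?R\<^esub> \<in> ?I"
        using zero_closed by (simp add: null_ideal_def mat_seq_ring_simps normalized_rank_zero)
      then show "?I \<noteq> {}"
        by blast
      show "\<ominus>\<^bsub>?R\<^esub> a \<in> ?I" if a: "a \<in> ?I" for a
      proof -
        have c: "a \<in> carrier ?R" and lim: "((\<lambda>k. normalized_rank (n k) (a k)) \<longlongrightarrow> 0) \<omega>"
          using a by (auto simp: null_ideal_def)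
        have "a k \<in> carrier_mat (n k) (n k)" for k
          using c by (simp add: mat_seq_ring_simps)
        then have "normalized_rank (n k) (- a k) = normalized_rank (n k) (a k)" for k
          by (rule normalized_rank_uminus)
        then show ?thesis
          using a_inv_closed[OF c] lim unfolding mat_seq_ring_uminus[OF c] null_ideal_def by simp
      qed
      show "a \<oplus>\<^bsub>?R\<^esub> b \<in> ?I" if "a \<in> ?I" "b \<in> ?I" for a b
      proof -
        have c: "a \<in> carrier ?R" "b \<in> carrier ?R"
          using that by (auto simp: null_ideal_def)
        have "((\<lambda>k. normalized_rank (n k) (a k) + normalized_rank (n k) (b k)) \<longlongrightarrow> 0) \<omega>"
          using tendsto_add[of "\<lambda>k. normalized_rank (n k) (a k)" 0 \<omega>
              "\<lambda>k. normalized_rank (n k) (b k)" 0] that by (simp add: null_ideal_def)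
        then have "((\<lambda>k. normalized_rank (n k) (a k + b k)) \<longlongrightarrow> 0) \<omega>"
          by (rule tendsto_zero_squeeze)
            (use c in \<open>auto simp: normalized_rank_nonneg mat_seq_ring_simps intro!: normalized_rank_add_le\<close>)
        then show ?thesis
          using add.m_closed[OF c] by (simp add: null_ideal_def mat_seq_ring_simps)
      qed
    qed
    fix a x assume ax: "a \<in> ?I" "x \<in> carrier ?R"
    then have c: "a \<in> carrier ?R" and lim: "((\<lambda>k. normalized_rank (n k) (a k)) \<longlongrightarrow> 0) \<omega>"
      by (auto simp: null_ideal_def)
    have "((\<lambda>k. normalized_rank (n k) (x k * a k)) \<longlongrightarrow> 0) \<omega>"
      using lim by (rule tendsto_zero_squeeze)
        (use c ax in \<open>auto simp: normalized_rank_nonneg mat_seq_ring_simps intro!: normalized_rank_mult_le\<close>)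
    then show "x \<otimes>\<^bsub>?R\<^esub> a \<in> ?I"
      using m_closed[OF ax(2) c] by (simp add: null_ideal_def mat_seq_ring_simps)
    have "((\<lambda>k. normalized_rank (n k) (a k * x k)) \<longlongrightarrow> 0) \<omega>"
      using lim by (rule tendsto_zero_squeeze)
        (use c ax in \<open>auto simp: normalized_rank_nonneg mat_seq_ring_simps intro!: normalized_rank_mult_le\<close>)
    then show "a \<otimes>\<^bsub>?R\<^esub> x \<in> ?I"
      using m_closed[OF c ax(2)] by (simp add: null_ideal_def mat_seq_ring_simps)
  qed (rule ring_mat_seq_ring)
qed

text \<open>Invertible lifts of the conjugating element suffice, and the relation may be checked in the form
\<open>\<phi> M - M \<psi> \<approx> 0\<close>, since multiplying this difference by \<open>M'\<close> does not increase ranks.\<close>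

lemma conjugateI:
  fixes \<phi> \<psi> :: "nat \<Rightarrow> 'a \<Rightarrow> 'k::field mat"
  assumes carr: "\<And>k a. \<phi> k a \<in> carrier_mat (n k) (n k)" "\<And>k a. \<psi> k a \<in> carrier_mat (n k) (n k)"
    "\<And>k. M k \<in> carrier_mat (n k) (n k)" "\<And>k. M' k \<in> carrier_mat (n k) (n k)"
    and inv: "\<And>k. M k * M' k = 1\<^sub>m (n k)" "\<And>k. M' k * M k = 1\<^sub>m (n k)"
    and lim: "\<And>a. ((\<lambda>k. normalized_rank (n k) (\<phi> k a * M k - M k * \<psi> k a)) \<longlongrightarrow> 0) \<omega>"
  shows "conjugate \<omega> n \<phi> \<psi>"
proof -
  let ?R = "mat_seq_ring n :: (nat \<Rightarrow> 'k mat) ring"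
  let ?I = "null_ideal \<omega> n :: (nat \<Rightarrow> 'k mat) set"
  let ?Q = "mat_ultraproduct \<omega> n :: (nat \<Rightarrow> 'k mat) set ring"
  interpret R: Ring.ring ?R
    by (rule ring_mat_seq_ring)
  interpret I: ideal ?I ?R
    by (rule ideal_null_ideal)
  interpret Q: Ring.ring ?Q
    unfolding mat_ultraproduct_def by (rule I.quotient_is_ring)
  have cls: "ultra_class \<omega> n x \<in> carrier ?Q" if "x \<in> carrier ?R" for x
    using that R.a_rcosetsI[OF I.a_subset] unfolding mat_ultraproduct_def ultra_class_def FactRing_def by simp
  have mult: "ultra_class \<omega> n x \<otimes>\<^bsub>?Q\<^esub> ultra_class \<omega> n y = ultra_class \<omega> n (\<lambda>k. x k * y k)"
    if "x \<in> carrier ?R" "y \<in> carrier ?R" for x y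
    using I.rcoset_mult_add[OF that]
    unfolding mat_ultraproduct_def ultra_class_def FactRing_def by (simp add: mat_seq_ring_simps)
  have one: "\<one>\<^bsub>?Q\<^esub> = ultra_class \<omega> n (\<lambda>k. 1\<^sub>m (n k))"
    unfolding mat_ultraproduct_def ultra_class_def FactRing_def by (simp add: mat_seq_ring_simps)
  have mem: "M \<in> carrier ?R" "M' \<in> carrier ?R" "(\<lambda>k. \<phi> k a) \<in> carrier ?R" "(\<lambda>k. \<psi> k a) \<in> carrier ?R" for a
    using carr by (auto simp: mat_seq_ring_simps)
  let ?M = "ultra_class \<omega> n M" and ?N = "ultra_class \<omega> n M'"
  have MN: "?M \<otimes>\<^bsub>?Q\<^esub> ?N = \<one>\<^bsub>?Q\<^esub>" "?N \<otimes>\<^bsub>?Q\<^esub> ?M = \<one>\<^bsub>?Q\<^esub>"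
    using mult mem inv one by auto
  then have unit: "?M \<in> Units ?Q"
    unfolding Units_def using cls mem by auto
  have inv_eq: "inv\<^bsub>?Q\<^esub> ?M = ?N"
    using MN cls mem by (intro Q.inv_char) auto
  have "ultra_class \<omega> n (\<lambda>k. \<phi> k a) = ?M \<otimes>\<^bsub>?Q\<^esub> ultra_class \<omega> n (\<lambda>k. \<psi> k a) \<otimes>\<^bsub>?Q\<^esub> ?N" for a
  proof -
    let ?y = "\<lambda>k. M k * \<psi> k a * M' k"
    have y: "?y \<in> carrier ?R"
      using R.m_closed[OF R.m_closed[OF mem(1,4)] mem(2), of a] by (simp add: mat_seq_ring_simps)
    have "\<phi> k a + - ?y k = (\<phi> k a * M k - M k * \<psi> k a) * M' k" for k
    proof -
      have "(\<phi> k a * M k - M k * \<psi> k a) * M' k = \<phi> k a * M k * M' k - M k * \<psi> k a * M' k"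
        by (intro minus_mult_distrib_mat[of _ "n k" "n k" _ _ "n k"] mult_carrier_mat[of _ _ "n k"] carr)
      also have "\<phi> k a * M k * M' k = \<phi> k a"
        using carr(1,2)[of k a] carr(3,4)[of k] inv(1)[of k] by (simp add: assoc_mult_mat[of _ "n k" "n k"])
      finally show ?thesis
        using carr(1,2)[of k a] carr(3,4)[of k] by (simp add: minus_add_uminus_mat[of _ "n k" "n k"])
    qed
    moreover have "\<phi> k a * M k - M k * \<psi> k a \<in> carrier_mat (n k) (n k)" for k
      by (intro minus_carrier_mat mult_carrier_mat[of _ _ "n k"] carr)
    then have "((\<lambda>k. normalized_rank (n k) ((\<phi> k a * M k - M k * \<psi> k a) * M' k)) \<longlongrightarrow> 0) \<omega>"
      using carr(4)
      by (intro tendsto_zero_squeeze[OF lim[of a]] normalized_rank_nonneg normalized_rank_mult_le)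
    ultimately have "(\<lambda>k. \<phi> k a) \<ominus>\<^bsub>?R\<^esub> ?y \<in> ?I"
      using mem(3)[of a] y R.minus_closed[OF mem(3) y, of a]
      by (simp add: null_ideal_def a_minus_def mat_seq_ring_uminus mat_seq_ring_simps)
    then have "ultra_class \<omega> n (\<lambda>k. \<phi> k a) = ultra_class \<omega> n ?y"
      using R.quotient_eq_iff_same_a_r_cos[OF ideal_null_ideal mem(3) y] unfolding ultra_class_def by simp
    moreover have "(\<lambda>k. M k * \<psi> k a) \<in> carrier ?R"
      using R.m_closed[OF mem(1,4)] by (simp add: mat_seq_ring_simps)
    ultimately show ?thesis
      using mult[OF mem(1,4)] mult[OF _ mem(2)] by simp
  qed
  then show ?thesis
    unfolding conjugate_def by (intro bexI[OF _ unit]) (simp add: inv_eq)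
qed

section \<open>Word filtration\<close>

sublocale assoc_algebra \<subseteq> linear_space scale ..

context assoc_algebra
begin

lemma filtration_mono: "r \<le> r' \<Longrightarrow> filtration S r \<subseteq> filtration S r'"
  unfolding filtration_def monomials_def by (intro span_mono) auto

lemma subspace_filtration: "subspace (filtration S r)"
  unfolding filtration_def by simp

lemma one_in_filtration: "1 \<in> filtration S r"
  unfolding filtration_def monomials_def by (intro span_base) (auto intro!: exI[of _ "[]"])

lemma fin_dim_filtration:
  assumes "finite S"
  shows "fin_dim (filtration S r)"
proof -
  have "monomials S r = prod_list ` {xs. set xs \<subseteq> S \<and> length xs \<le> r}"
    unfolding monomials_def by auto
  then have "finite (monomials S r)"
    using finite_lists_length_le[OF assms] by simp
  then show ?thesis
    unfolding filtration_def fin_dim_def by blast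
qed

lemma fin_dim_subset_filtration:
  assumes "generating_set S" "fin_dim W"
  shows "\<exists>d. W \<subseteq> filtration S d"
proof -
  have sub: "subspace (\<Union>r. filtration S r)"
  proof (rule subspaceI)
    fix x y c assume "x \<in> (\<Union>r. filtration S r)"
    then obtain i where i: "x \<in> filtration S i"
      by blast
    then show "scale c x \<in> (\<Union>r. filtration S r)"
      using subspace_scale[OF subspace_filtration] by blast
    assume "y \<in> (\<Union>r. filtration S r)"
    then obtain j where "y \<in> filtration S j"
      by blast
    then have "x \<in> filtration S (max i j)" "y \<in> filtration S (max i j)"
      using i filtration_mono[of i "max i j" S] filtration_mono[of j "max i j" S] by auto
    then show "x + y \<in> (\<Union>r. filtration S r)"
      using subspace_add[OF subspace_filtration] by blast
  next
    show "0 \<in> (\<Union>r. filtration S r)"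
      using subspace_0[OF subspace_filtration] by blast
  qed
  have "span (\<Union>r. monomials S r) \<subseteq> (\<Union>r. filtration S r)"
    using span_superset unfolding filtration_def[of S]
    by (intro span_minimal sub[unfolded filtration_def[of S]]) blast
  then have all: "x \<in> (\<Union>r. filtration S r)" for x
    using assms(1) unfolding generating_set_def by blast
  obtain B where B: "finite B" "W \<subseteq> span B"
    using assms(2) unfolding fin_dim_def by blast
  have "\<exists>d. B \<subseteq> filtration S d"
    using B(1)
  proof (induction B rule: finite_induct)
    case (insert b B)
    then obtain d where d: "B \<subseteq> filtration S d"
      by blast
    obtain e where "b \<in> filtration S e"
      using all by blast
    then have "insert b B \<subseteq> filtration S (max d e)"
      using d filtration_mono[of d "max d e" S] filtration_mono[of e "max d e" S] by auto
    then show ?case ..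
  qed simp
  then obtain d where "B \<subseteq> filtration S d" ..
  then have "span B \<subseteq> filtration S d"
    using span_minimal[OF _ subspace_filtration] by blast
  then show ?thesis
    using B(2) by blast
qed

section \<open>Unpacking approximations\<close>

lemma linear_to_mat_carrier: "linear_to_mat n \<phi> \<Longrightarrow> \<phi> a \<in> carrier_mat n n"
  unfolding linear_to_mat_def by blast

lemma linear_action_mat_op:
  assumes "linear_to_mat n \<phi>"
  shows "linear_action scale fscale (\<lambda>a. mat_op n (\<phi> a))"
proof (intro linear_action.intro linear_action_axioms.intro)
  show "linear_space_pair scale (fscale :: 'k \<Rightarrow> _)"
    by unfold_locales
  have c: "\<phi> a \<in> carrier_mat n n" for a
    using assms by (rule linear_to_mat_carrier)
  show "Vector_Spaces.linear scale fscale (\<lambda>w. mat_op n (\<phi> w) v)" for v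
    using assms mat_op_add[OF c c] mat_op_smult[OF c] unfolding linear_to_mat_def
    by (simp add: linear_fscale_iff[OF vector_space_axioms]) (simp add: fscale_def)
  show "Vector_Spaces.linear fscale fscale (mat_op n (\<phi> w))" for w
    by (rule linear_mat_op)
qed

text \<open>The defining conditions of a \<open>d\<close>-approximation, transported to \<open>coord_space n\<close>, with the subspace
on which \<open>\<phi>\<close> is multiplicative as an explicit argument.\<close>

definition approx_on :: "'a set \<Rightarrow> nat \<Rightarrow> nat \<Rightarrow> ('a \<Rightarrow> 'k mat) \<Rightarrow> (nat \<Rightarrow> 'k) set \<Rightarrow> bool" where
  "approx_on S d n \<phi> U \<longleftrightarrow>
    linear_to_mat n \<phi> \<and> fs.subspace U \<and> U \<subseteq> coord_space n \<and>
    (\<forall>x\<in>filtration S d. \<forall>y\<in>filtration S d. \<forall>u\<in>U.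
      mat_op n (\<phi> (x * y)) u = mat_op n (\<phi> x) (mat_op n (\<phi> y) u)) \<and>
    real (fs.dim U) \<ge> (1 - 1 / real d) * real n \<and>
    (\<forall>a\<in>filtration S d. a \<noteq> 0 \<longrightarrow>
      real (fs.dim (mat_op n (\<phi> a) ` coord_space n)) \<ge> (1 - 1 / real d) * real n)"

lemma approximation_imp_approx_on:
  assumes "approximation_of S d n \<phi>" "n > 0"
  shows "\<exists>U. approx_on S d n \<phi> U"
proof -
  obtain U where lin: "linear_to_mat n \<phi>"
    and U: "VectorSpace.subspace class_ring U (module_vec TYPE('k) n)"
    and mult: "\<And>x y u. x \<in> filtration S d \<Longrightarrow> y \<in> filtration S d \<Longrightarrow> u \<in> U \<Longrightarrow>
        \<phi> (x * y) *\<^sub>v u = (\<phi> x * \<phi> y) *\<^sub>v u"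
    and dimU: "real (vectorspace.dim class_ring (module_vec TYPE('k) n\<lparr>carrier := U\<rparr>))
        \<ge> (1 - 1 / real d) * real n"
    and rk: "\<And>a. a \<in> filtration S d \<Longrightarrow> a \<noteq> 0 \<Longrightarrow> normalized_rank n (\<phi> a) \<ge> 1 - 1 / real d"
    using assms(1) unfolding approximation_of_def by blast
  have c: "\<phi> a \<in> carrier_mat n n" for a
    using lin by (rule linear_to_mat_carrier)
  have "mat_op n (\<phi> (x * y)) f = mat_op n (\<phi> x) (mat_op n (\<phi> y) f)"
    if xy: "x \<in> filtration S d" "y \<in> filtration S d" and f: "f \<in> vec_seq n ` U" for x y f
  proof -
    obtain u where u: "u \<in> U" "f = vec_seq n u"
      using f by blast
    have uc: "u \<in> carrier_vec n"
      using u(1) subspace_carrier[OF U] by blast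
    have "vec_seq n (\<phi> (x * y) *\<^sub>v u) = vec_seq n ((\<phi> x * \<phi> y) *\<^sub>v u)"
      using mult xy u by simp
    then show ?thesis
      using u uc vec_seq_mult_mat_vec[OF c uc] vec_seq_mult_mat_vec[OF mult_carrier_mat[OF c c] uc]
        mat_op_mult[OF c c] by metis
  qed
  moreover have "real (fs.dim (mat_op n (\<phi> a) ` coord_space n)) \<ge> (1 - 1 / real d) * real n"
    if "a \<in> filtration S d" "a \<noteq> 0" for a
    using rk[OF that] assms(2) rank_eq_dim_range[OF c]
    by (simp add: normalized_rank_def pos_le_divide_eq)
  ultimately have "approx_on S d n \<phi> (vec_seq n ` U)"
    unfolding approx_on_def using lin subspace_vec_seq[OF U] dimU dim_vec_seq[OF U] vec_seq_in
    by auto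
  then show ?thesis ..
qed

lemma approx_on_kernel:
  assumes "approx_on S d n \<phi> U" "a \<in> filtration S d" "a \<noteq> 0"
  shows "real (fs.dim {f \<in> coord_space n. mat_op n (\<phi> a) f = 0}) \<le> real n / real d"
proof -
  let ?F = "coord_space n :: (nat \<Rightarrow> 'k) set"
  have "fs.dim ?F = fs.dim (mat_op n (\<phi> a) ` ?F) + fs.dim {f \<in> ?F. mat_op n (\<phi> a) f = 0}"
    by (intro fs2.rank_nullity linear_mat_op subspace_coord_space fin_dim_coord_space)
  then have "real n = real (fs.dim (mat_op n (\<phi> a) ` ?F)) + real (fs.dim {f \<in> ?F. mat_op n (\<phi> a) f = 0})"
    unfolding dim_coord_space by (simp flip: of_nat_add)
  moreover have "real (fs.dim (mat_op n (\<phi> a) ` ?F)) \<ge> (1 - 1 / real d) * real n"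
    using assms unfolding approx_on_def by blast
  moreover have "(1 - 1 / real d) * real n = real n - real n / real d"
    by (simp add: left_diff_distrib)
  ultimately show ?thesis
    by linarith
qed

section \<open>Extending tilings\<close>

abbreviation mat_tiling :: "nat \<Rightarrow> ('a \<Rightarrow> 'k mat) \<Rightarrow> 'a set \<Rightarrow> (nat \<Rightarrow> 'k) list \<Rightarrow> bool" where
  "mat_tiling n \<phi> \<equiv> linear_action.tiling fscale (\<lambda>a. mat_op n (\<phi> a))"

abbreviation mat_tile_span :: "nat \<Rightarrow> ('a \<Rightarrow> 'k mat) \<Rightarrow> 'a set \<Rightarrow> (nat \<Rightarrow> 'k) list \<Rightarrow> (nat \<Rightarrow> 'k) set" where
  "mat_tile_span n \<phi> \<equiv> linear_action.tile_span fscale (\<lambda>a. mat_op n (\<phi> a))"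

text \<open>With \<open>D = dim W\<close>, suppose that a nonzero \<open>w\<close> maps \<open>U\<close> into a space of dimension at most
\<open>dim E + 2 D\<^sup>2\<close>, where \<open>E\<close> is the span of the tiling and \<open>dim E < (1 - \<epsilon>) n\<close>. As \<open>w\<close> kills only \<open>n / d\<close>
dimensions and \<open>U\<close> misses only \<open>n / d\<close>, this gives \<open>n - 2 n / d < (1 - \<epsilon>) n + 2 D\<^sup>2\<close>, and with
\<open>2 / d \<le> \<epsilon> / 2\<close> it contradicts \<open>\<epsilon> n \<ge> 4 D\<^sup>2\<close>. So \<open>generic_vector\<close> applies.\<close>

lemma tiling_step_large:
  assumes ap: "approx_on S d n \<phi> U" and W: "subspace W" "fin_dim W" "W \<subseteq> filtration S d"
    and d: "1 / real d \<le> \<epsilon> / 4"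
    and n: "4 * real (dim W) * real (dim W) \<le> \<epsilon> * real n"
    and vs: "mat_tiling n \<phi> W vs" "real (length vs * dim W) < (1 - \<epsilon>) * real n"
  shows "\<exists>v\<in>U. \<forall>w\<in>W. mat_op n (\<phi> w) v \<in> mat_tile_span n \<phi> W vs \<longrightarrow> w = 0"
proof -
  have lin: "linear_to_mat n \<phi>" and U: "fs.subspace U" "U \<subseteq> coord_space n"
    and dimU: "real (fs.dim U) \<ge> (1 - 1 / real d) * real n"
    using ap unfolding approx_on_def by auto
  interpret act: linear_action scale fscale "\<lambda>a. mat_op n (\<phi> a)"
    using lin by (rule linear_action_mat_op)
  let ?E = "act.tile_span W vs"
  have dimE: "fs.dim ?E = length vs * dim W"
    using act.dim_tile_span[OF vs(1) order_refl W(1,2)] .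
  have fU: "fs.fin_dim U"
    by (rule fs.fin_dim_subset[OF U(2) fin_dim_coord_space])
  show ?thesis
  proof (rule act.generic_vector[OF W(1,2) U(1) _ act.subspace_tile_span act.fin_dim_tile_span[OF W(2)] order_refl])
    fix w and E :: "(nat \<Rightarrow> 'k) set"
    assume w: "w \<in> W" "w \<noteq> 0" and E: "fs.subspace E" "fs.fin_dim E"
      and dE: "fs.dim E \<le> fs.dim ?E + 2 * dim W * dim W"
    show "\<not> mat_op n (\<phi> w) ` U \<subseteq> E"
    proof
      assume sub: "mat_op n (\<phi> w) ` U \<subseteq> E"
      have "fs.dim U = fs.dim (mat_op n (\<phi> w) ` U) + fs.dim {f \<in> U. mat_op n (\<phi> w) f = 0}"
        by (rule fs2.rank_nullity[OF linear_mat_op U(1) fU])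
      moreover have "fs.dim (mat_op n (\<phi> w) ` U) \<le> fs.dim E"
        by (rule fs.fin_dim_dim_mono[OF sub E(2)])
      moreover have "fs.dim {f \<in> U. mat_op n (\<phi> w) f = 0}
          \<le> fs.dim {f \<in> coord_space n. mat_op n (\<phi> w) f = 0}"
        using U(2) by (intro fs.fin_dim_dim_mono fs.fin_dim_subset[OF _ fin_dim_coord_space]) auto
      ultimately have "fs.dim U \<le> length vs * dim W + 2 * dim W * dim W
          + fs.dim {f \<in> coord_space n. mat_op n (\<phi> w) f = 0}"
        using dE dimE by linarith
      then have "real (fs.dim U) \<le> real (length vs * dim W) + 2 * real (dim W) * real (dim W)
          + real (fs.dim {f \<in> coord_space n. mat_op n (\<phi> w) f = 0})"
        unfolding of_nat_le_iff[where 'a=real, symmetric] by simp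
      moreover have "real (fs.dim {f \<in> coord_space n. mat_op n (\<phi> w) f = 0}) \<le> real n / real d"
        using approx_on_kernel[OF ap _ w(2)] w(1) W(3) by blast
      moreover have "real n / real d \<le> \<epsilon> / 4 * real n"
        using mult_right_mono[OF d, of "real n"] by simp
      moreover have "real n - real n / real d \<le> real (fs.dim U)"
        using dimU by (simp add: left_diff_distrib)
      ultimately show False
        using n vs(2)[unfolded left_diff_distrib] by linarith
    qed
  qed
qed

text \<open>For \<open>n < d\<close> all the defects, being integers below \<open>n / d < 1\<close>, vanish: \<open>U\<close> is everything and
nonzero elements act injectively. The span \<open>E\<close> of the tiling is invariant under the algebra, so each
nonzero \<open>w\<close> maps \<open>E\<close> onto itself, and a vector that \<open>w\<close> maps into \<open>E\<close> already lies in \<open>E\<close>.\<close>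

lemma tiling_step_small:
  assumes ap: "approx_on S d n \<phi> U" and UNIV: "filtration S d = UNIV" "fin_dim UNIV"
    and n: "n < d"
    and vs: "mat_tiling n \<phi> UNIV vs" "set vs \<subseteq> U" "length vs * dim UNIV < n"
  shows "\<exists>v\<in>U. \<forall>w. mat_op n (\<phi> w) v \<in> mat_tile_span n \<phi> UNIV vs \<longrightarrow> w = 0"
proof -
  let ?F = "coord_space n :: (nat \<Rightarrow> 'k) set"
  have lin: "linear_to_mat n \<phi>" and U: "fs.subspace U" "U \<subseteq> coord_space n"
    and mult: "\<And>x y u. u \<in> U \<Longrightarrow> mat_op n (\<phi> (x * y)) u = mat_op n (\<phi> x) (mat_op n (\<phi> y) u)"
    and dimU: "real (fs.dim U) \<ge> (1 - 1 / real d) * real n"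
    using ap UNIV(1) unfolding approx_on_def by auto
  interpret act: linear_action scale fscale "\<lambda>a. mat_op n (\<phi> a)"
    using lin by (rule linear_action_mat_op)
  let ?E = "act.tile_span UNIV vs"
  have less1: "real n / real d < 1"
    using n by simp
  have dimE: "fs.dim ?E = length vs * dim UNIV"
    using act.dim_tile_span[OF vs(1) order_refl subspace_UNIV UNIV(2)] .
  have "real (fs.dim U) > real n - 1"
  proof -
    have "real n - real n / real d \<le> real (fs.dim U)"
      using dimU by (simp add: left_diff_distrib)
    then show ?thesis
      using less1 by linarith
  qed
  then have "fs.dim ?F \<le> fs.dim U"
    unfolding dim_coord_space by linarith
  then have UF: "U = ?F"
    by (rule fs.subspace_eqI_dim[OF U(2,1) fin_dim_coord_space])
  have inj: "f = 0" if w: "w \<noteq> 0" and f: "f \<in> ?F" "mat_op n (\<phi> w) f = 0" for w f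
  proof -
    have "real (fs.dim {f \<in> ?F. mat_op n (\<phi> w) f = 0}) < 1"
      using approx_on_kernel[OF ap _ w] UNIV(1) less1 by fastforce
    then have "{f \<in> ?F. mat_op n (\<phi> w) f = 0} \<subseteq> {0}"
      by (intro fs.dim_eq_0_imp fs.fin_dim_subset[OF _ fin_dim_coord_space]) auto
    then show ?thesis
      using f by blast
  qed
  have EF: "?E \<subseteq> ?F"
    unfolding act.tile_span_def by (intro fs.span_minimal subspace_coord_space) (auto simp: mat_op_in)
  have "fs.dim ?E \<noteq> fs.dim ?F"
    using dimE vs(3) by (simp add: dim_coord_space)
  then obtain v where v: "v \<in> ?F" "v \<notin> ?E"
    using EF by (metis subsetI subset_antisym)
  have "w = 0" if wv: "mat_op n (\<phi> w) v \<in> ?E" for w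
  proof (rule ccontr)
    assume w: "w \<noteq> 0"
    have "?E \<subseteq> {f. mat_op n (\<phi> w) f \<in> ?E}"
    proof -
      have "mat_op n (\<phi> w) (mat_op n (\<phi> x) u) \<in> ?E" if "u \<in> set vs" for x u
        using act.act_in_tile_span[OF that, of "w * x" UNIV] mult[of u w x] that vs(2) by auto
      then show ?thesis
        by (subst (1) act.tile_span_def)
          (intro fs.span_minimal fs2.linear_subspace_linear_preimage[OF linear_mat_op act.subspace_tile_span],
            auto)
    qed
    then have sub: "mat_op n (\<phi> w) ` ?E \<subseteq> ?E"
      by blast
    have "fs.dim (mat_op n (\<phi> w) ` ?E) = fs.dim ?E"
      using inj[OF w] EF
      by (intro fs2.dim_image_inj linear_mat_op act.subspace_tile_span act.fin_dim_tile_span UNIV) auto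
    then have "mat_op n (\<phi> w) ` ?E = ?E"
      by (intro fs.subspace_eqI_dim sub fs2.linear_subspace_image linear_mat_op act.subspace_tile_span
          act.fin_dim_tile_span UNIV) simp
    then obtain e where e: "e \<in> ?E" "mat_op n (\<phi> w) v = mat_op n (\<phi> w) e"
      using wv by (metis imageE)
    have "v - e \<in> ?F"
      using v e EF fs.subspace_diff[OF subspace_coord_space] by blast
    moreover have "mat_op n (\<phi> w) (v - e) = 0"
      using e by (simp add: fs2.linear_diff[OF linear_mat_op])
    ultimately show False
      using inj[OF w] v e by fastforce
  qed
  then show ?thesis
    using v UF by blast
qed

section \<open>Tilings of sofic representations\<close>

text \<open>A \<open>d\<close>-approximation with \<open>d \<ge> 2\<close> is injective on \<open>filtration S d\<close>, since nonzero elements have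
positive rank there. If the matrices have size at most \<open>C\<close>, its values lie in a space of dimension at
most \<open>C\<^sup>2\<close>, which is impossible once \<open>filtration S d\<close> contains more than \<open>C\<^sup>2\<close> independent elements.\<close>

lemma sofic_rep_dim_unbounded:
  assumes gen: "generating_set S" and rep: "linear_sofic_rep S n \<phi>" and inf: "\<not> fin_dim UNIV"
  shows "eventually (\<lambda>k. C < n k) sequentially"
proof -
  obtain B where B: "independent B" "UNIV \<subseteq> span B"
    using basis_exists[of UNIV] by metis
  have "infinite B"
    using inf B unfolding fin_dim_def by blast
  then obtain B0 where B0: "finite B0" "card B0 = Suc (C * C)" "B0 \<subseteq> B"
    using infinite_arbitrarily_large by blast
  have ind: "independent B0"
    using B(1) B0(3) independent_mono by blast
  have fB: "fin_dim (span B0)"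
    unfolding fin_dim_def using B0 by blast
  obtain d0 where d0: "span B0 \<subseteq> filtration S d0"
    using fin_dim_subset_filtration[OF gen fB] by blast
  define d where "d = max 2 d0"
  have d: "span B0 \<subseteq> filtration S d"
    using d0 filtration_mono[of d0 d S] unfolding d_def by simp
  have "eventually (\<lambda>k. approximation_of S d (n k) (\<phi> k)) sequentially"
    using rep unfolding linear_sofic_rep_def d_def by simp
  then show ?thesis
  proof (rule eventually_mono)
    fix k assume ap: "approximation_of S d (n k) (\<phi> k)"
    have n0: "n k > 0" and lin: "linear_to_mat (n k) (\<phi> k)"
      using rep unfolding linear_sofic_rep_def by auto
    define N where "N = n k"
    obtain U where U: "approx_on S d N (\<phi> k) U"
      using approximation_imp_approx_on[OF ap n0] unfolding N_def by blast
    have carr: "\<phi> k a \<in> carrier_mat N N" for a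
      using linear_to_mat_carrier[OF lin] unfolding N_def .
    \<comment> \<open>The entries of \<open>\<phi> k a\<close>, listed row by row, so that a matrix becomes an element of
    \<open>coord_space (N * N)\<close>.\<close>
    define h where "h a = (\<lambda>l. if l < N * N then \<phi> k a $$ (l div N, l mod N) else 0)" for a
    have lN: "l div N < N \<and> l mod N < N" if "l < N * N" for l
      using that n0 unfolding N_def by (simp add: less_mult_imp_div_less)
    interpret P: linear_space_pair scale "fscale :: 'k \<Rightarrow> _" ..
    have lh: "Vector_Spaces.linear scale fscale h"
    proof -
      have "\<phi> k (a + b) = \<phi> k a + \<phi> k b" "\<phi> k (scale c a) = c \<cdot>\<^sub>m \<phi> k a" for a b c
        using lin unfolding linear_to_mat_def by auto
      then show ?thesis
        using lN by (auto simp: linear_fscale_iff[OF vector_space_axioms] h_def carrier_matD[OF carr])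
    qed
    have inj: "a = 0" if a: "a \<in> span B0" "h a = 0" for a
    proof (rule ccontr)
      assume a0: "a \<noteq> 0"
      have "\<phi> k a $$ (i, j) = 0" if "i < N" "j < N" for i j
      proof -
        have "i * N + j < N * N"
        proof -
          have "i * N + j < i * N + N"
            using that by simp
          also have "\<dots> = Suc i * N"
            by simp
          also have "\<dots> \<le> N * N"
            using that by (intro mult_right_mono) auto
          finally show ?thesis .
        qed
        then have "h a (i * N + j) = \<phi> k a $$ (i, j)"
          using that by (simp add: h_def)
        then show ?thesis
          using a(2) by simp
      qed
      then have "mat_op N (\<phi> k a) f = 0" for f
        by (auto simp: mat_op_def fun_eq_iff)
      then have "{f \<in> coord_space N. mat_op N (\<phi> k a) f = 0} = coord_space N"
        by blast
      then have "real N \<le> real N / real d"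
        using approx_on_kernel[OF U _ a0] a(1) d dim_coord_space[of N, where 'k='k] by auto
      moreover have "real N / real d \<le> real N / 2"
        unfolding d_def by (intro divide_left_mono) auto
      ultimately show False
        using n0 unfolding N_def by simp
    qed
    have "fs.dim (h ` span B0) = dim (span B0)"
      using inj by (intro P.dim_image_inj lh subspace_span fB)
    also have "\<dots> = Suc (C * C)"
      using dim_span_eq_card_independent[OF ind] B0(2) by simp
    finally have "fs.dim (h ` span B0) = Suc (C * C)" .
    moreover have "h ` span B0 \<subseteq> coord_space (N * N)"
      by (auto simp: h_def coord_space_def)
    ultimately have "Suc (C * C) \<le> fs.dim (coord_space (N * N) :: (nat \<Rightarrow> 'k) set)"
      using fs.fin_dim_dim_mono[OF _ fin_dim_coord_space] by metis
    then have "C * C < N * N"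
      by (simp add: dim_coord_space)
    then show "C < n k"
      unfolding N_def using mult_le_mono[of "n k" C "n k" C] by (meson leD leI)
  qed
qed

text \<open>The same \<open>m\<close> is available for every representation of dimension \<open>n k\<close>, which is what allows
two tilings to be matched. The choice \<open>W = UNIV\<close> in finite dimension makes the small case exact.\<close>

lemma eventually_tiling:
  assumes gen: "generating_set S" and rep: "linear_sofic_rep S n \<phi>"
    and W: "subspace W" "fin_dim W" "fin_dim UNIV \<Longrightarrow> W = UNIV"
    and eps: "\<epsilon> > 0"
  shows "eventually (\<lambda>k. \<forall>m. (\<forall>i<m. real (i * dim W) < (1 - \<epsilon>) * real (n k)) \<longrightarrow>
    (\<exists>vs. length vs = m \<and> mat_tiling (n k) (\<phi> k) W vs \<and>
      (\<forall>v\<in>set vs. \<forall>x\<in>filtration S r. \<forall>y\<in>W.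
        mat_op (n k) (\<phi> k (x * y)) v = mat_op (n k) (\<phi> k x) (mat_op (n k) (\<phi> k y) v))))
    sequentially"
proof -
  obtain d0 where d0: "W \<subseteq> filtration S d0"
    using fin_dim_subset_filtration[OF gen W(2)] by blast
  obtain d1 :: nat where d1: "4 / \<epsilon> \<le> real d1"
    using real_arch_simple by blast
  obtain C :: nat where C: "4 * real (dim W) * real (dim W) / \<epsilon> \<le> real C"
    using real_arch_simple by blast
  define d where "d = Suc (Max {d0, d1, C, r})"
  have ge: "d0 \<le> d" "d1 \<le> d" "C < d" "r \<le> d" "d \<ge> 1"
    unfolding d_def by auto
  have Wd: "W \<subseteq> filtration S d"
    using d0 filtration_mono[OF ge(1), of S] by blast
  have rd: "filtration S r \<subseteq> filtration S d"
    using filtration_mono[OF ge(4)] .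
  have "4 / \<epsilon> \<le> real d"
    using d1 ge(2) by linarith
  then have d_eps: "1 / real d \<le> \<epsilon> / 4"
    using eps ge(5) by (simp add: field_simps)
  have "eventually (\<lambda>k. approximation_of S d (n k) (\<phi> k)) sequentially"
    using rep ge(5) unfolding linear_sofic_rep_def by simp
  moreover have "eventually (\<lambda>k. fin_dim UNIV \<or> C < n k) sequentially"
    using sofic_rep_dim_unbounded[OF gen rep] by (cases "fin_dim UNIV") auto
  ultimately show ?thesis
  proof eventually_elim
    case (elim k)
    have n0: "n k > 0" and lin: "linear_to_mat (n k) (\<phi> k)"
      using rep unfolding linear_sofic_rep_def by auto
    obtain U where ap: "approx_on S d (n k) (\<phi> k) U"
      using approximation_imp_approx_on[OF elim(1) n0] by blast
    have mult: "mat_op (n k) (\<phi> k (x * y)) u = mat_op (n k) (\<phi> k x) (mat_op (n k) (\<phi> k y) u)"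
      if "x \<in> filtration S r" "y \<in> W" "u \<in> U" for x y u
      using ap that Wd rd unfolding approx_on_def by blast
    interpret act: linear_action scale fscale "\<lambda>a. mat_op (n k) (\<phi> k a)"
      using lin by (rule linear_action_mat_op)
    have step: "\<exists>v\<in>U. \<forall>w\<in>W. mat_op (n k) (\<phi> k w) v \<in> act.tile_span W vs \<longrightarrow> w = 0"
      if vs: "set vs \<subseteq> U" "act.tiling W vs" "real (length vs * dim W) < (1 - \<epsilon>) * real (n k)" for vs
    proof (cases "C < n k")
      case True
      have "4 * real (dim W) * real (dim W) \<le> real C * \<epsilon>"
        using C eps by (simp add: pos_divide_le_eq)
      also have "\<dots> \<le> \<epsilon> * real (n k)"
        using True eps by simp
      finally show ?thesis
        using tiling_step_large[OF ap W(1,2) Wd d_eps _ vs(2,3)] by blast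
    next
      case False
      then have fd: "fin_dim UNIV" and W_UNIV: "W = UNIV" and nd: "n k < d"
        using elim(2) W(3) ge(3) by auto
      have "(1 - \<epsilon>) * real (n k) \<le> real (n k)"
        using eps by (simp add: left_diff_distrib)
      then have "real (length vs * dim W) < real (n k)"
        using vs(3) by linarith
      then have len: "length vs * dim W < n k"
        unfolding of_nat_less_iff .
      show ?thesis
        using tiling_step_small[OF ap _ fd nd _ vs(1)] vs(2) len Wd W_UNIV by auto
    qed
    show ?case
    proof (intro allI impI)
      fix m assume "\<forall>i<m. real (i * dim W) < (1 - \<epsilon>) * real (n k)"
      then obtain vs where "length vs = m" "set vs \<subseteq> U" "act.tiling W vs"
        using act.exists_tiling[OF step] by blast
      then show "\<exists>vs. length vs = m \<and> act.tiling W vs \<and>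
        (\<forall>v\<in>set vs. \<forall>x\<in>filtration S r. \<forall>y\<in>W.
          mat_op (n k) (\<phi> k (x * y)) v = mat_op (n k) (\<phi> k x) (mat_op (n k) (\<phi> k y) v))"
        using mult by (intro exI[of _ vs]) auto
    qed
  qed
qed

section \<open>Folner subspaces\<close>

lemma folner_subspace:
  assumes am: amenable and V: "subspace V" "fin_dim V" "1 \<in> V" and nz: "(1::'a) \<noteq> 0"
    and \<delta>: "\<delta> > 0"
  shows "\<exists>W. subspace W \<and> fin_dim W \<and> dim W > 0 \<and> (fin_dim UNIV \<longrightarrow> W = UNIV) \<and>
    real (dim (prod_space V W)) < (1 + \<delta>) * real (dim W)"
proof -
  obtain W :: "nat \<Rightarrow> 'a set" where W: "\<And>n. fin_dim_subspace (W n)" "\<And>n. W n \<subseteq> W (Suc n)"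
    "(\<Union>n. W n) = UNIV"
    "\<And>V. fin_dim_subspace V \<Longrightarrow> V \<noteq> {0} \<Longrightarrow>
      (\<lambda>n. real (dim (prod_space V (W n))) / real (dim (W n))) \<longlonglongrightarrow> 1"
    using am unfolding amenable_def by blast
  have mono: "m \<le> n \<Longrightarrow> W m \<subseteq> W n" for m n
    using lift_Suc_mono_le[of W, OF W(2)] .
  have sW: "subspace (W n)" "fin_dim (W n)" for n
    using W(1) unfolding fin_dim_subspace_def fin_dim_def by auto
  have ev: "eventually (\<lambda>n. x \<in> W n) sequentially" for x
  proof -
    obtain m where "x \<in> W m"
      using W(3) by blast
    then show ?thesis
      using mono by (intro eventually_sequentiallyI[of m]) blast
  qed
  have "eventually (\<lambda>n. fin_dim UNIV \<longrightarrow> W n = UNIV) sequentially"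
  proof (cases "fin_dim UNIV")
    case True
    then obtain B where B: "finite B" "UNIV \<subseteq> span B"
      unfolding fin_dim_def by blast
    have "eventually (\<lambda>n. \<forall>b\<in>B. b \<in> W n) sequentially"
      using ev B(1) by (intro eventually_ball_finite) auto
    then show ?thesis
      using B(2) span_minimal[OF _ sW(1)] by (elim eventually_mono) blast
  qed simp
  moreover have "V \<noteq> {0}"
    using V(3) nz by blast
  then have "(\<lambda>n. real (dim (prod_space V (W n))) / real (dim (W n))) \<longlonglongrightarrow> 1"
    using W(4) V unfolding fin_dim_subspace_def fin_dim_def by blast
  then have "eventually (\<lambda>n. real (dim (prod_space V (W n))) / real (dim (W n)) < 1 + \<delta>) sequentially"
    using \<delta> by (intro order_tendstoD) auto
  ultimately have "eventually (\<lambda>n. (fin_dim UNIV \<longrightarrow> W n = UNIV) \<and> 1 \<in> W n \<and>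
      real (dim (prod_space V (W n))) / real (dim (W n)) < 1 + \<delta>) sequentially"
    using ev[of 1] by eventually_elim auto
  then obtain n where n: "fin_dim UNIV \<longrightarrow> W n = UNIV" "1 \<in> W n"
      "real (dim (prod_space V (W n))) / real (dim (W n)) < 1 + \<delta>"
    using eventually_happens'[OF sequentially_bot] by blast
  have "dim (W n) > 0"
    using dim_eq_0_imp[OF sW(2)] n(2) nz by force
  then show ?thesis
    using n sW by (intro exI[of _ "W n"]) (simp add: pos_divide_less_eq)
qed

lemma linear_mult_left: "Vector_Spaces.linear scale scale ((*) x)"
  using vector_space_axioms by (simp add: Vector_Spaces.linear_iff distrib_left scale_mult_right)

lemma fin_dim_prod_space:
  assumes "fin_dim V" "fin_dim W"
  shows "fin_dim (prod_space V W)"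
proof -
  obtain B C where BC: "finite B" "V \<subseteq> span B" "finite C" "W \<subseteq> span C"
    using assms unfolding fin_dim_def by blast
  let ?P = "(\<lambda>(b, c). b * c) ` (B \<times> C)"
  interpret e: linear_space_pair scale scale ..
  have linl: "Vector_Spaces.linear scale scale (\<lambda>x. x * y)" for y
    using vector_space_axioms by (simp add: Vector_Spaces.linear_iff distrib_right scale_mult_left)
  have "x * y \<in> span ?P" if x: "x \<in> span B" and y: "y \<in> span C" for x y
  proof -
    have 1: "b * y \<in> span ?P" if b: "b \<in> B" for b
    proof -
      have "b * y \<in> span ((*) b ` C)"
        using y e.linear_span_image[OF linear_mult_left] by blast
      also have "\<dots> \<subseteq> span ?P"
        using b by (intro span_mono) auto
      finally show ?thesis .
    qed
    have "x * y \<in> span ((\<lambda>x. x * y) ` B)"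
      using x e.linear_span_image[OF linl] by blast
    also have "\<dots> \<subseteq> span ?P"
      using 1 by (intro span_minimal) auto
    finally show ?thesis .
  qed
  then have "prod_space V W \<subseteq> span ?P"
    unfolding prod_space_def using BC by (intro span_minimal) auto
  then show ?thesis
    unfolding fin_dim_def using BC by (intro exI[of _ ?P]) auto
qed

text \<open>Left multiplication by \<open>a\<close> maps \<open>W\<close> into \<open>VW\<close>, which also contains \<open>W\<close> because \<open>1 \<in> V\<close>. So the
elements of \<open>W\<close> that leave \<open>W\<close> account for at most \<open>dim VW - dim W\<close> dimensions.\<close>

lemma dim_translation_stable:
  assumes V: "fin_dim V" "1 \<in> V" "a \<in> V" and W: "subspace W" "fin_dim W"
  shows "2 * dim W \<le> dim {w \<in> W. a * w \<in> W} + dim (prod_space V W)"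
proof -
  interpret e: linear_space_pair scale scale ..
  have sub: "x * w \<in> prod_space V W" if "x \<in> V" "w \<in> W" for x w
    using that unfolding prod_space_def by (intro span_base) auto
  have "W \<subseteq> prod_space V W"
    using sub[OF V(2)] by auto
  moreover have "(*) a ` W \<subseteq> prod_space V W"
    using sub[OF V(3)] by blast
  ultimately have "dim W + dim W \<le> dim {w \<in> W. a * w \<in> W} + dim (prod_space V W)"
    using W by (intro e.dim_preimage linear_mult_left fin_dim_prod_space V) (auto simp: prod_space_def)
  then show ?thesis
    by simp
qed

section \<open>Uniqueness\<close>

text \<open>Both the uncovered part and the non-invariant part of \<open>W\<close> are kept below the proportion
\<open>\<epsilon> = 1 / (2 r)\<close>. The kernel of the defect then has dimension at least \<open>(1 - \<epsilon>)\<^sup>2 n \<ge> (1 - 1 / r) n\<close>.\<close>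

lemma eventually_intertwiner:
  assumes fin: "finite S" and gen: "generating_set S" and am: amenable and nz: "(1::'a) \<noteq> 0"
    and rep: "linear_sofic_rep S n \<phi>" "linear_sofic_rep S n \<psi>" and r: "r \<ge> 1"
  shows "eventually (\<lambda>k. \<exists>M M'. M \<in> carrier_mat (n k) (n k) \<and> M' \<in> carrier_mat (n k) (n k) \<and>
    M * M' = 1\<^sub>m (n k) \<and> M' * M = 1\<^sub>m (n k) \<and>
    (\<forall>a\<in>filtration S r. normalized_rank (n k) (\<phi> k a * M - M * \<psi> k a) \<le> 1 / real r)) sequentially"
proof -
  let ?V = "filtration S r"
  define \<epsilon> :: real where "\<epsilon> = 1 / (2 * real r)"
  have eps: "\<epsilon> > 0" "\<epsilon> \<le> 1"
    using r by (auto simp: \<epsilon>_def)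
  note fV = fin_dim_filtration[OF fin, of r]
  obtain W where W: "subspace W" "fin_dim W" "dim W > 0" "fin_dim UNIV \<longrightarrow> W = UNIV"
    and PW: "real (dim (prod_space ?V W)) < (1 + \<epsilon>) * real (dim W)"
    using folner_subspace[OF am subspace_filtration fV one_in_filtration nz eps(1)] by blast
  let ?T = "\<lambda>\<phi> k. \<forall>m. (\<forall>i<m. real (i * dim W) < (1 - \<epsilon>) * real (n k)) \<longrightarrow>
    (\<exists>vs. length vs = m \<and> mat_tiling (n k) (\<phi> k) W vs \<and>
      (\<forall>v\<in>set vs. \<forall>x\<in>?V. \<forall>y\<in>W.
        mat_op (n k) (\<phi> k (x * y)) v = mat_op (n k) (\<phi> k x) (mat_op (n k) (\<phi> k y) v)))"
  have "eventually (?T \<phi>) sequentially" "eventually (?T \<psi>) sequentially"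
    using eventually_tiling[OF gen rep(1) W(1,2) _ eps(1)] eventually_tiling[OF gen rep(2) W(1,2) _ eps(1)]
      W(4) by blast+
  then show ?thesis
  proof eventually_elim
    case (elim k)
    let ?n = "n k"
    let ?F = "coord_space ?n :: (nat \<Rightarrow> 'k) set"
    have n0: "?n > 0" and lin: "linear_to_mat ?n (\<phi> k)" "linear_to_mat ?n (\<psi> k)"
      using rep unfolding linear_sofic_rep_def by auto
    interpret f: linear_action scale fscale "\<lambda>a. mat_op ?n (\<phi> k a)"
      using lin(1) by (rule linear_action_mat_op)
    interpret g: linear_action scale fscale "\<lambda>a. mat_op ?n (\<psi> k a)"
      using lin(2) by (rule linear_action_mat_op)
    have c: "\<phi> k a \<in> carrier_mat ?n ?n" "\<psi> k a \<in> carrier_mat ?n ?n" for a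
      using lin linear_to_mat_carrier by auto
    \<comment> \<open>The least number of copies of \<open>W\<close> that cover the proportion \<open>1 - \<epsilon>\<close>: it is attained by greedy
    extension, and it depends on \<open>n k\<close> only, not on the representation.\<close>
    define m where "m = (LEAST m. (1 - \<epsilon>) * real ?n \<le> real (m * dim W))"
    have "(1 - \<epsilon>) * real ?n \<le> real (?n * dim W)"
    proof -
      have "(1 - \<epsilon>) * real ?n \<le> 1 * real ?n"
        using eps by (intro mult_right_mono) auto
      also have "\<dots> \<le> real (?n * dim W)"
        using W(3) mult_left_mono[of 1 "real (dim W)" "real ?n"] by simp
      finally show ?thesis .
    qed
    then have m: "(1 - \<epsilon>) * real ?n \<le> real (m * dim W)"
      unfolding m_def by (rule LeastI)
    have less: "\<forall>i<m. real (i * dim W) < (1 - \<epsilon>) * real ?n"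
      unfolding m_def by (auto dest!: not_less_Least simp: not_le)
    obtain vs where vs_all: "length vs = m \<and> f.tiling W vs \<and> (\<forall>v\<in>set vs. \<forall>x\<in>?V. \<forall>y\<in>W.
        mat_op ?n (\<phi> k (x * y)) v = mat_op ?n (\<phi> k x) (mat_op ?n (\<phi> k y) v))"
      using elim(1)[THEN spec, THEN mp, OF less] ..
    then have vs: "length vs = m" "f.tiling W vs"
      "\<And>v x y. v \<in> set vs \<Longrightarrow> x \<in> ?V \<Longrightarrow> y \<in> W \<Longrightarrow>
        mat_op ?n (\<phi> k (x * y)) v = mat_op ?n (\<phi> k x) (mat_op ?n (\<phi> k y) v)"
      by simp_all
    obtain us where us_all: "length us = m \<and> g.tiling W us \<and> (\<forall>v\<in>set us. \<forall>x\<in>?V. \<forall>y\<in>W.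
        mat_op ?n (\<psi> k (x * y)) v = mat_op ?n (\<psi> k x) (mat_op ?n (\<psi> k y) v))"
      using elim(2)[THEN spec, THEN mp, OF less] ..
    then have us: "length us = m" "g.tiling W us"
      "\<And>v x y. v \<in> set us \<Longrightarrow> x \<in> ?V \<Longrightarrow> y \<in> W \<Longrightarrow>
        mat_op ?n (\<psi> k (x * y)) v = mat_op ?n (\<psi> k x) (mat_op ?n (\<psi> k y) v)"
      by simp_all
    have len: "length us = length vs"
      using us(1) vs(1) by simp
    obtain h h' where h: "Vector_Spaces.linear fscale fscale h" "Vector_Spaces.linear fscale fscale h'"
      "h ` ?F \<subseteq> ?F" "h' ` ?F \<subseteq> ?F" "\<And>x. x \<in> ?F \<Longrightarrow> h (h' x) = x" "\<And>x. x \<in> ?F \<Longrightarrow> h' (h x) = x"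
      "\<And>i w. i < length vs \<Longrightarrow> w \<in> W \<Longrightarrow> h (mat_op ?n (\<psi> k w) (us ! i)) = mat_op ?n (\<phi> k w) (vs ! i)"
      by (rule f.tiling_isomorphism[OF f.linear_action_axioms g.linear_action_axioms W(1,2)
            subspace_coord_space fin_dim_coord_space mat_op_in mat_op_in vs(2) us(2) len]) (rule that)
    define M where "M = mat_of_op ?n h"
    define M' where "M' = mat_of_op ?n h'"
    have cM: "M \<in> carrier_mat ?n ?n" "M' \<in> carrier_mat ?n ?n"
      unfolding M_def M'_def by (rule mat_of_op_carrier)+
    have opM: "mat_op ?n M x = h x" "mat_op ?n M' x = h' x" if "x \<in> ?F" for x
      unfolding M_def M'_def
      using mat_op_mat_of_op[OF h(1,3) that] mat_op_mat_of_op[OF h(2,4) that] by simp_all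
    have MM': "M * M' = 1\<^sub>m ?n"
    proof (rule mat_eqI_op[OF mult_carrier_mat[OF cM] one_carrier_mat])
      fix x assume x: "x \<in> ?F"
      then have "h' x \<in> ?F"
        using h(4) by blast
      then show "mat_op ?n (M * M') x = mat_op ?n (1\<^sub>m ?n) x"
        using x opM h(5) by (simp add: mat_op_mult[OF cM] mat_op_one)
    qed
    have M'M: "M' * M = 1\<^sub>m ?n"
    proof (rule mat_eqI_op[OF mult_carrier_mat[OF cM(2,1)] one_carrier_mat])
      fix x assume x: "x \<in> ?F"
      then have "h x \<in> ?F"
        using h(3) by blast
      then show "mat_op ?n (M' * M) x = mat_op ?n (1\<^sub>m ?n) x"
        using x opM h(6) by (simp add: mat_op_mult[OF cM(2,1)] mat_op_one)
    qed
    have "normalized_rank ?n (\<phi> k a * M - M * \<psi> k a) \<le> 1 / real r" if a: "a \<in> ?V" for a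
    proof -
      let ?X = "\<phi> k a * M - M * \<psi> k a"
      define Wa where "Wa = {w \<in> W. a * w \<in> W}"
      have Wa: "subspace Wa" "Wa \<subseteq> W" "fin_dim Wa"
      proof -
        show "Wa \<subseteq> W"
          unfolding Wa_def by blast
        then show "fin_dim Wa"
          using fin_dim_subset W(2) by blast
        show "subspace Wa"
          unfolding Wa_def using W(1) subspaceI[of Wa]
          by (auto simp: subspace_def Wa_def distrib_left scale_mult_right)
      qed
      define Z where "Z = g.tile_span Wa us"
      have dimZ: "fs.dim Z = m * dim Wa"
        unfolding Z_def using g.dim_tile_span[OF us(2) Wa(2,1,3)] us(1) by simp
      have cX: "?X \<in> carrier_mat ?n ?n"
        by (intro minus_carrier_mat mult_carrier_mat[of _ _ ?n] c cM)
      have opX: "mat_op ?n ?X x = mat_op ?n (\<phi> k a) (h x) - h (mat_op ?n (\<psi> k a) x)" if "x \<in> ?F" for x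
        by (simp add: opM(1)[OF that] opM(1)[OF mat_op_in] mat_op_diff[OF mult_carrier_mat[OF c(1) cM(1)] mult_carrier_mat[OF cM(1) c(2)]]
            mat_op_mult[OF c(1) cM(1)] mat_op_mult[OF cM(1) c(2)])
      have "mat_op ?n ?X (mat_op ?n (\<psi> k w) u) = 0" if w: "w \<in> Wa" and u: "u \<in> set us" for w u
      proof -
        obtain i where i: "i < length vs" "u = us ! i"
          using u us(1) vs(1) by (auto simp: in_set_conv_nth)
        then have v: "vs ! i \<in> set vs"
          by simp
        have w': "w \<in> W" "a * w \<in> W"
          using w unfolding Wa_def by auto
        have "h (mat_op ?n (\<psi> k a) (mat_op ?n (\<psi> k w) u)) = h (mat_op ?n (\<psi> k (a * w)) u)"
          using us(3)[OF u a w'(1)] by simp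
        also have "\<dots> = mat_op ?n (\<phi> k (a * w)) (vs ! i)"
          using h(7)[OF i(1) w'(2)] i(2) by simp
        also have "\<dots> = mat_op ?n (\<phi> k a) (mat_op ?n (\<phi> k w) (vs ! i))"
          using vs(3)[OF v a w'(1)] .
        also have "\<dots> = mat_op ?n (\<phi> k a) (h (mat_op ?n (\<psi> k w) u))"
          using h(7)[OF i(1) w'(1)] i(2) by simp
        finally show ?thesis
          by (simp add: opX[OF mat_op_in])
      qed
      then have "Z \<subseteq> {x. mat_op ?n ?X x = 0}"
        unfolding Z_def g.tile_span_def
        by (intro fs.span_minimal fs2.linear_subspace_kernel[OF linear_mat_op]) auto
      moreover have "Z \<subseteq> ?F"
        unfolding Z_def g.tile_span_def
        by (intro fs.span_minimal subspace_coord_space) (auto simp: mat_op_in)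
      moreover have "fs.subspace Z"
        unfolding Z_def by (rule g.subspace_tile_span)
      ultimately have "vec_space.rank ?n ?X + fs.dim Z \<le> ?n"
        by (intro rank_le_codim_kernel[OF cX]) auto
      then have rk: "real (vec_space.rank ?n ?X) + real m * real (dim Wa) \<le> real ?n"
        unfolding dimZ by (simp flip: of_nat_mult of_nat_add)
      have "2 * dim W \<le> dim Wa + dim (prod_space ?V W)"
        unfolding Wa_def by (rule dim_translation_stable[OF fV one_in_filtration a W(1,2)])
      then have "2 * real (dim W) \<le> real (dim Wa) + real (dim (prod_space ?V W))"
        by (simp flip: of_nat_add)
      then have "(1 - \<epsilon>) * real (dim W) \<le> real (dim Wa)"
        using PW by (simp add: distrib_right left_diff_distrib)
      then have "real m * ((1 - \<epsilon>) * real (dim W)) \<le> real m * real (dim Wa)"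
        by (intro mult_left_mono) auto
      moreover have "(1 - \<epsilon>) * ((1 - \<epsilon>) * real ?n) \<le> (1 - \<epsilon>) * real (m * dim W)"
        using m eps by (intro mult_left_mono) auto
      moreover have "(1 - 2 * \<epsilon>) * real ?n \<le> (1 - \<epsilon>) * ((1 - \<epsilon>) * real ?n)"
      proof -
        have "(1 - \<epsilon>) * ((1 - \<epsilon>) * real ?n) = (1 - 2 * \<epsilon>) * real ?n + \<epsilon> * \<epsilon> * real ?n"
          by (simp add: algebra_simps)
        then show ?thesis
          using eps by simp
      qed
      moreover have "(1 - \<epsilon>) * real (m * dim W) = real m * ((1 - \<epsilon>) * real (dim W))"
        by simp
      ultimately have "(1 - 2 * \<epsilon>) * real ?n \<le> real m * real (dim Wa)"
        by (metis order_trans)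
      then have "real (vec_space.rank ?n ?X) \<le> 2 * \<epsilon> * real ?n"
        using rk by (simp add: left_diff_distrib)
      then have "normalized_rank ?n ?X \<le> 2 * \<epsilon>"
        using n0 by (simp add: normalized_rank_def pos_divide_le_eq)
      then show ?thesis
        by (simp add: \<epsilon>_def)
    qed
    then show ?case
      using cM MM' M'M by blast
  qed
qed

text \<open>Take the largest \<open>r \<le> k\<close> with \<open>P r k\<close>, and \<open>0\<close> if there is none.\<close>

lemma diagonal_index:
  fixes P :: "nat \<Rightarrow> nat \<Rightarrow> bool"
  assumes "\<And>r. r \<ge> 1 \<Longrightarrow> eventually (P r) sequentially"
  shows "\<exists>\<rho>. (\<forall>k. \<rho> k \<ge> 1 \<longrightarrow> P (\<rho> k) k) \<and> (\<forall>r. eventually (\<lambda>k. r \<le> \<rho> k) sequentially)"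
proof -
  define R where "R k = {r. r \<le> k \<and> (r \<ge> 1 \<longrightarrow> P r k)}" for k
  have fin: "finite (R k)" for k
    unfolding R_def by simp
  have "0 \<in> R k" for k
    unfolding R_def by simp
  then have "Max (R k) \<in> R k" for k
    using fin by (intro Max_in) auto
  then have "Max (R k) \<ge> 1 \<longrightarrow> P (Max (R k)) k" for k
    unfolding R_def by blast
  moreover have "eventually (\<lambda>k. r \<le> Max (R k)) sequentially" for r
  proof (cases "r \<ge> 1")
    case True
    show ?thesis
      using assms[OF True] eventually_ge_at_top[of r]
    proof eventually_elim
      case (elim k)
      then have "r \<in> R k"
        unfolding R_def by simp
      then show ?case
        using fin Max_ge by blast
    qed
  qed (simp add: not_le)
  ultimately show ?thesis
    by (intro exI[of _ "\<lambda>k. Max (R k)"]) auto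
qed

lemma sofic_reps_conjugate:
  assumes fin: "finite S" and gen: "generating_set S" and am: amenable and nz: "(1::'a) \<noteq> 0"
    and rep: "linear_sofic_rep S n \<phi>" "linear_sofic_rep S n \<psi>"
    and \<omega>: "\<omega> \<le> sequentially"
  shows "conjugate \<omega> n \<phi> \<psi>"
proof -
  let ?inv = "\<lambda>k M M'. M \<in> carrier_mat (n k) (n k) \<and> M' \<in> carrier_mat (n k) (n k) \<and>
    M * M' = 1\<^sub>m (n k) \<and> M' * M = 1\<^sub>m (n k)"
  let ?P = "\<lambda>r k M M'. \<forall>a\<in>filtration S r.
    normalized_rank (n k) (\<phi> k a * M - M * \<psi> k a) \<le> 1 / real r"
  have "eventually (\<lambda>k. \<exists>M M'. ?inv k M M' \<and> ?P r k M M') sequentially" if "r \<ge> 1" for r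
    using eventually_intertwiner[OF fin gen am nz rep that] by (simp add: conj_assoc)
  from diagonal_index[of "\<lambda>r k. \<exists>M M'. ?inv k M M' \<and> ?P r k M M'", OF this]
  obtain \<rho> where \<rho>: "\<And>k. \<rho> k \<ge> 1 \<Longrightarrow> \<exists>M M'. ?inv k M M' \<and> ?P (\<rho> k) k M M'"
    "\<And>r. eventually (\<lambda>k. r \<le> \<rho> k) sequentially"
    by blast
  have "\<exists>M M'. ?inv k M M' \<and> (\<rho> k \<ge> 1 \<longrightarrow> ?P (\<rho> k) k M M')" for k
  proof (cases "\<rho> k \<ge> 1")
    case False
    then show ?thesis
      by (intro exI[of _ "1\<^sub>m (n k)"]) auto
  qed (use \<rho>(1) in blast)
  then obtain M M' where M: "\<And>k. ?inv k (M k) (M' k)"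
    "\<And>k. \<rho> k \<ge> 1 \<Longrightarrow> ?P (\<rho> k) k (M k) (M' k)"
    by metis
  have lin: "linear_to_mat (n k) (\<phi> k)" "linear_to_mat (n k) (\<psi> k)" for k
    using rep unfolding linear_sofic_rep_def by auto
  show ?thesis
  proof (rule conjugateI[where M = M and M' = M'])
    fix a
    have "fin_dim {a}"
      unfolding fin_dim_def using span_superset by blast
    then obtain r0 where r0: "a \<in> filtration S r0"
      using fin_dim_subset_filtration[OF gen] by blast
    have "((\<lambda>k. normalized_rank (n k) (\<phi> k a * M k - M k * \<psi> k a)) \<longlongrightarrow> 0) sequentially"
    proof (rule tendsto_sandwich[OF _ _ tendsto_const])
      have "filterlim \<rho> at_top sequentially"
        using \<rho>(2) by (simp add: filterlim_at_top)
      then show "((\<lambda>k. 1 / real (\<rho> k)) \<longlongrightarrow> 0) sequentially"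
        using filterlim_compose[OF lim_1_over_n] by blast
      show "eventually (\<lambda>k. normalized_rank (n k) (\<phi> k a * M k - M k * \<psi> k a) \<le> 1 / real (\<rho> k)) sequentially"
        using \<rho>(2)[of "max 1 r0"]
      proof eventually_elim
        case (elim k)
        then have "a \<in> filtration S (\<rho> k)"
          using r0 filtration_mono[of r0 "\<rho> k" S] by auto
        then show ?case
          using M(2) elim by simp
      qed
    qed (simp add: normalized_rank_nonneg)
    then show "((\<lambda>k. normalized_rank (n k) (\<phi> k a * M k - M k * \<psi> k a)) \<longlongrightarrow> 0) \<omega>"
      using \<omega> filterlim_mono by blast
  qed (use M(1) lin linear_to_mat_carrier in auto)
qed

section \<open>Existence\<close>

lemma approx_on_imp_approximation:
  assumes ap: "approx_on S d n \<phi> U" and n: "n > 0"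
  shows "approximation_of S d n \<phi>"
proof -
  have lin: "linear_to_mat n \<phi>" and U: "fs.subspace U" "U \<subseteq> coord_space n"
    and mult: "\<And>x y u. x \<in> filtration S d \<Longrightarrow> y \<in> filtration S d \<Longrightarrow> u \<in> U \<Longrightarrow>
      mat_op n (\<phi> (x * y)) u = mat_op n (\<phi> x) (mat_op n (\<phi> y) u)"
    and dimU: "real (fs.dim U) \<ge> (1 - 1 / real d) * real n"
    and rk: "\<And>a. a \<in> filtration S d \<Longrightarrow> a \<noteq> 0 \<Longrightarrow>
      real (fs.dim (mat_op n (\<phi> a) ` coord_space n)) \<ge> (1 - 1 / real d) * real n"
    using ap unfolding approx_on_def by auto
  have c: "\<phi> a \<in> carrier_mat n n" for a
    using lin by (rule linear_to_mat_carrier)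
  define U' where "U' = {v \<in> carrier_vec n. vec_seq n v \<in> U}"
  have "VectorSpace.subspace class_ring U' (module_vec TYPE('k) n)"
    unfolding U'_def using U(1) by (rule subspace_vec_seq_preimage)
  moreover have "vec_seq n ` U' = U"
    unfolding U'_def using U(2) by (rule image_vec_seq_preimage)
  moreover have "\<phi> (x * y) *\<^sub>v u = (\<phi> x * \<phi> y) *\<^sub>v u"
    if xy: "x \<in> filtration S d" "y \<in> filtration S d" and u: "u \<in> U'" for x y u
  proof -
    have uc: "u \<in> carrier_vec n" and uU: "vec_seq n u \<in> U"
      using u unfolding U'_def by auto
    have "vec_seq n (\<phi> (x * y) *\<^sub>v u) = vec_seq n ((\<phi> x * \<phi> y) *\<^sub>v u)"
      using mult[OF xy uU] vec_seq_mult_mat_vec[OF c uc] vec_seq_mult_mat_vec[OF mult_carrier_mat[OF c c] uc]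
        mat_op_mult[OF c c] by simp
    moreover have "\<phi> (x * y) *\<^sub>v u \<in> carrier_vec n" "(\<phi> x * \<phi> y) *\<^sub>v u \<in> carrier_vec n"
      using mult_mat_vec_carrier[OF c uc] mult_mat_vec_carrier[OF mult_carrier_mat[OF c c] uc] by auto
    ultimately show ?thesis
      using vec_vec_seq by metis
  qed
  moreover have "normalized_rank n (\<phi> a) \<ge> 1 - 1 / real d" if "a \<in> filtration S d" "a \<noteq> 0" for a
    using rk[OF that] n rank_eq_dim_range[OF c] by (simp add: normalized_rank_def pos_le_divide_eq)
  ultimately show ?thesis
    unfolding approximation_of_def using lin dimU dim_vec_seq[of U' n]
    by (intro conjI exI[of _ U']) auto
qed

text \<open>The map \<open>e\<close> parametrizes \<open>W\<close>; the map \<open>c\<close>, defined on the whole algebra, is a linear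
projection to \<open>W\<close> followed by the inverse of \<open>e\<close>.\<close>

lemma coordinate_maps:
  assumes W: "subspace W" "fin_dim W"
  obtains e c where "Vector_Spaces.linear fscale scale e" "Vector_Spaces.linear scale fscale c"
    "e ` coord_space (dim W) = W" "\<And>a. c a \<in> coord_space (dim W)"
    "\<And>f. f \<in> coord_space (dim W) \<Longrightarrow> c (e f) = f" "\<And>w. w \<in> W \<Longrightarrow> e (c w) = w"
proof -
  let ?F = "coord_space (dim W) :: (nat \<Rightarrow> 'k) set"
  interpret P: linear_space_pair "fscale :: 'k \<Rightarrow> _" scale ..
  obtain B where B: "finite B" "independent B" "span B = W" "card B = dim W"
    using fin_dim_basis[OF W(2,1)] by blast
  obtain C where C: "finite C" "fs.independent C" "fs.span C = ?F" "card C = fs.dim ?F"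
    using fs.fin_dim_basis[OF fin_dim_coord_space subspace_coord_space] by blast
  have "B \<subseteq> W" "W \<subseteq> span B" "C \<subseteq> ?F" "?F \<subseteq> fs.span C"
    using B(3) C(3) span_superset[of B] fs.span_superset[of C] by auto
  then obtain e where e: "Vector_Spaces.linear fscale scale e" "e ` ?F = W" "inj_on e ?F"
    using P.finite_basis_to_basis_subspace_isomorphism[OF subspace_coord_space W(1)
        dim_coord_space C(1) _ C(2) _ C(4) B(1) _ B(2) _ B(4)] by blast
  obtain c where c: "range c \<subseteq> ?F" "Vector_Spaces.linear scale fscale c" "\<forall>f\<in>?F. c (e f) = f"
    using P.linear_exists_left_inverse_on[OF e(1) subspace_coord_space e(3)] by blast
  have ecw: "e (c w) = w" if w: "w \<in> W" for w
  proof -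
    obtain f where "f \<in> ?F" "w = e f"
      using w e(2) by blast
    then show ?thesis
      using c(3) by simp
  qed
  show ?thesis
    by (rule that[OF e(1) c(2) e(2) _ _ ecw]) (use c in auto)
qed

text \<open>Each element of \<open>B\<close> costs at most \<open>dim VW - dim W\<close> dimensions; the subtractions are avoided by
moving these terms to the other side.\<close>

lemma dim_stable_vectors:
  assumes W: "subspace W" "fin_dim W" and V: "fin_dim V" "1 \<in> V" and B: "finite B" "B \<subseteq> V"
  shows "dim W + card B * dim W \<le> dim {w \<in> W. \<forall>y\<in>B. y * w \<in> W} + card B * dim (prod_space V W)"
  using B
proof (induction B rule: finite_induct)
  case (insert y B)
  interpret e: linear_space_pair scale scale ..
  let ?X = "{w \<in> W. \<forall>y\<in>B. y * w \<in> W}"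
  have sX: "subspace ?X"
    using W(1) by (auto simp: subspace_def distrib_left scale_mult_right)
  have fX: "fin_dim ?X"
    by (rule fin_dim_subset[OF _ W(2)]) auto
  have sub: "x * w \<in> prod_space V W" if "x \<in> V" "w \<in> W" for x w
    using that unfolding prod_space_def by (intro span_base) auto
  have 1: "W \<subseteq> prod_space V W"
    using sub[OF V(2)] by auto
  have 2: "(*) y ` ?X \<subseteq> prod_space V W"
    using insert.prems sub by auto
  have "dim ?X + dim W \<le> dim {w \<in> ?X. y * w \<in> W} + dim (prod_space V W)"
    by (intro e.dim_preimage linear_mult_left sX fX fin_dim_prod_space V W 1 2)
      (simp add: prod_space_def)
  moreover have "{w \<in> ?X. y * w \<in> W} = {w \<in> W. \<forall>y\<in>insert y B. y * w \<in> W}"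
    by auto
  ultimately have "dim ?X + dim W \<le> dim {w \<in> W. \<forall>y\<in>insert y B. y * w \<in> W} + dim (prod_space V W)"
    by metis
  then show ?case
    using insert by simp
qed simp

text \<open>The matrix of \<open>a\<close> describes \<open>w \<mapsto> P (a w)\<close> on \<open>W\<close>, with \<open>P\<close> the projection to \<open>W\<close>. On vectors that
stay in \<open>W\<close> under the filtration step the projection does nothing: there products are
respected, and a nonzero \<open>a\<close> acts injectively because there are no zero divisors.\<close>

lemma compression_approx_on:
  assumes dom: "\<And>x y :: 'a. x * y = 0 \<Longrightarrow> x = 0 \<or> y = 0"
    and W: "subspace W" "fin_dim W"
    and e: "Vector_Spaces.linear fscale scale e" and c: "Vector_Spaces.linear scale fscale c"
    and ec: "e ` coord_space (dim W) = W" "\<And>a. c a \<in> coord_space (dim W)"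
      "\<And>f. f \<in> coord_space (dim W) \<Longrightarrow> c (e f) = f" "\<And>w. w \<in> W \<Longrightarrow> e (c w) = w"
  defines "\<phi> \<equiv> \<lambda>a. mat_of_op (dim W) (\<lambda>f. c (a * e f))"
  shows "linear_to_mat (dim W) \<phi>"
    and "real (dim {w \<in> W. \<forall>y\<in>filtration S d. y * w \<in> W}) \<ge> (1 - 1 / real d) * real (dim W) \<Longrightarrow>
      \<exists>U. approx_on S d (dim W) \<phi> U"
proof -
  let ?F = "coord_space (dim W) :: (nat \<Rightarrow> 'k) set"
  interpret E: linear_space_pair "fscale :: 'k \<Rightarrow> _" scale ..
  interpret C: linear_space_pair scale "fscale :: 'k \<Rightarrow> _" ..
  interpret ee: linear_space_pair scale scale ..
  show lin: "linear_to_mat (dim W) \<phi>"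
    unfolding linear_to_mat_def \<phi>_def mat_of_op_def
    by (auto simp: mat_eq_iff distrib_right scale_mult_left C.linear_add[OF c] C.linear_scale[OF c]
        fscale_def)
  have op: "mat_op (dim W) (\<phi> a) f = c (a * e f)" if "f \<in> ?F" for a f
  proof -
    have "Vector_Spaces.linear fscale fscale (c \<circ> ((*) a \<circ> e))"
      by (rule Vector_Spaces.linear_compose[OF Vector_Spaces.linear_compose[OF e linear_mult_left] c])
    then have "Vector_Spaces.linear fscale fscale (\<lambda>f. c (a * e f))"
      by (simp add: comp_def)
    moreover have "(\<lambda>f. c (a * e f)) ` ?F \<subseteq> ?F"
      using ec(2) by blast
    ultimately show ?thesis
      unfolding \<phi>_def using that by (rule mat_op_mat_of_op)
  qed
  let ?X = "{w \<in> W. \<forall>y\<in>filtration S d. y * w \<in> W}"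
  assume dimX: "real (dim ?X) \<ge> (1 - 1 / real d) * real (dim W)"
  have sX: "subspace ?X"
    using W(1) by (auto simp: subspace_def distrib_left scale_mult_right)
  have fX: "fin_dim ?X"
    by (rule fin_dim_subset[OF _ W(2)]) auto
  define U where "U = c ` ?X"
  have sU: "fs.subspace U"
    unfolding U_def by (rule C.linear_subspace_image[OF c sX])
  have UF: "U \<subseteq> ?F"
    unfolding U_def using ec(2) by blast
  have fU: "fs.fin_dim U"
    by (rule fs.fin_dim_subset[OF UF fin_dim_coord_space])
  have eU: "e f \<in> ?X" if "f \<in> U" for f
    using that ec(4) unfolding U_def by auto
  have "fs.dim U = dim ?X"
    unfolding U_def
  proof (rule C.dim_image_inj[OF c sX fX])
    fix x assume "x \<in> ?X" "c x = 0"
    then show "x = 0"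
      using ec(4)[of x] E.linear_0[OF e] by auto
  qed
  then have dimU: "real (fs.dim U) \<ge> (1 - 1 / real d) * real (dim W)"
    using dimX by simp
  have mult: "mat_op (dim W) (\<phi> (x * y)) u = mat_op (dim W) (\<phi> x) (mat_op (dim W) (\<phi> y) u)"
    if "x \<in> filtration S d" "y \<in> filtration S d" "u \<in> U" for x y u
  proof -
    have "u \<in> ?F" "y * e u \<in> W"
      using that UF eU by auto
    then show ?thesis
      using op[OF ec(2)] ec(4) by (simp add: op mult.assoc)
  qed
  have rk: "real (fs.dim (mat_op (dim W) (\<phi> a) ` ?F)) \<ge> (1 - 1 / real d) * real (dim W)"
    if a: "a \<in> filtration S d" "a \<noteq> 0" for a
  proof -
    have "fs.dim (mat_op (dim W) (\<phi> a) ` U) = fs.dim U"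
    proof (rule fs2.dim_image_inj[OF linear_mat_op sU fU])
      fix f assume f: "f \<in> U" "mat_op (dim W) (\<phi> a) f = 0"
      then have "c (a * e f) = 0" "a * e f \<in> W"
        using op UF eU a by auto
      then have "a * e f = 0"
        using ec(4)[of "a * e f"] E.linear_0[OF e] by simp
      then have "e f = 0"
        using dom a(2) by blast
      then show "f = 0"
        using ec(3)[of f] f(1) UF C.linear_0[OF c] by auto
    qed
    moreover have "fs.dim (mat_op (dim W) (\<phi> a) ` U) \<le> fs.dim (mat_op (dim W) (\<phi> a) ` ?F)"
      using UF by (intro fs.fin_dim_dim_mono image_mono fs.fin_dim_subset[OF _ fin_dim_coord_space[of "dim W"]])
        (auto simp: mat_op_in)
    ultimately show ?thesis
      using dimU by linarith
  qed
  show "\<exists>U. approx_on S d (dim W) \<phi> U"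
    unfolding approx_on_def using lin sU UF mult dimU rk by (intro exI[of _ U]) auto
qed

text \<open>For fixed \<open>d\<close> the filtration step has a finite spanning set, so by \<open>dim_stable_vectors\<close> the
proportion of vectors of \<open>W k\<close> that leave \<open>W k\<close> under it tends to \<open>0\<close>.\<close>

lemma sofic_rep_exists:
  assumes dom: "\<And>x y :: 'a. x * y = 0 \<Longrightarrow> x = 0 \<or> y = 0" and nz: "(1::'a) \<noteq> 0"
    and fin: "finite S" and am: amenable
  shows "\<exists>n \<phi>. linear_sofic_rep S n \<phi>"
proof -
  obtain W0 :: "nat \<Rightarrow> 'a set" where W0: "\<And>n. fin_dim_subspace (W0 n)" "\<And>n. W0 n \<subseteq> W0 (Suc n)"
    "(\<Union>n. W0 n) = UNIV"
    "\<And>V. fin_dim_subspace V \<Longrightarrow> V \<noteq> {0} \<Longrightarrow>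
      (\<lambda>n. real (dim (prod_space V (W0 n))) / real (dim (W0 n))) \<longlonglongrightarrow> 1"
    using am unfolding amenable_def by blast
  obtain k0 where k0: "1 \<in> W0 k0"
    using W0(3) by blast
  \<comment> \<open>The shift makes \<open>1\<close> belong to every \<open>W k\<close>, so that all matrix sizes are positive.\<close>
  define W where "W k = W0 (k + k0)" for k
  have W: "subspace (W k)" "fin_dim (W k)" for k
    using W0(1) unfolding W_def fin_dim_subspace_def fin_dim_def by auto
  have "1 \<in> W k" for k
    using k0 lift_Suc_mono_le[of W0, OF W0(2), of k0 "k + k0"] unfolding W_def by auto
  then have pos: "dim (W k) > 0" for k
    using dim_eq_0_imp[OF W(2)] nz by force
  have "\<exists>e c. Vector_Spaces.linear fscale scale e \<and> Vector_Spaces.linear scale fscale c \<and>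
    e ` coord_space (dim (W k)) = W k \<and> (\<forall>a. c a \<in> coord_space (dim (W k))) \<and>
    (\<forall>f\<in>coord_space (dim (W k)). c (e f) = f) \<and> (\<forall>w\<in>W k. e (c w) = w)" for k
    by (rule coordinate_maps[OF W(1,2)[of k]]) (intro exI conjI allI ballI; assumption?)+
  then obtain e c where ec: "\<And>k. Vector_Spaces.linear fscale scale (e k)"
    "\<And>k. Vector_Spaces.linear scale fscale (c k)"
    "\<And>k. e k ` coord_space (dim (W k)) = W k" "\<And>k a. c k a \<in> coord_space (dim (W k))"
    "\<And>k f. f \<in> coord_space (dim (W k)) \<Longrightarrow> c k (e k f) = f" "\<And>k w. w \<in> W k \<Longrightarrow> e k (c k w) = w"
    by metis
  define \<phi> where "\<phi> k a = mat_of_op (dim (W k)) (\<lambda>f. c k (a * e k f))" for k a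
  have lin: "linear_to_mat (dim (W k)) (\<phi> k)" for k
    unfolding \<phi>_def by (rule compression_approx_on(1)[OF dom W(1,2) ec(1-6)])
  have "eventually (\<lambda>k. approximation_of S d (dim (W k)) (\<phi> k)) sequentially" if d: "d \<ge> 1" for d
  proof -
    let ?V = "filtration S d"
    obtain B where B: "finite B" "span B = ?V"
      using fin_dim_basis[OF fin_dim_filtration[OF fin] subspace_filtration] by metis
    define \<delta> where "\<delta> = 1 / (real d * real (Suc (card B)))"
    have \<delta>: "\<delta> > 0"
      unfolding \<delta>_def using d by simp
    have "?V \<noteq> {0}"
      using one_in_filtration nz by blast
    then have "(\<lambda>n. real (dim (prod_space ?V (W0 n))) / real (dim (W0 n))) \<longlonglongrightarrow> 1"
      using W0(4) fin_dim_filtration[OF fin] subspace_filtration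
      unfolding fin_dim_subspace_def fin_dim_def by blast
    then have "(\<lambda>k. real (dim (prod_space ?V (W k))) / real (dim (W k))) \<longlonglongrightarrow> 1"
      unfolding W_def by (rule LIMSEQ_ignore_initial_segment)
    then have "eventually (\<lambda>k. real (dim (prod_space ?V (W k))) / real (dim (W k)) < 1 + \<delta>) sequentially"
      using \<delta> by (intro order_tendstoD) auto
    then show ?thesis
    proof (rule eventually_mono)
      fix k assume "real (dim (prod_space ?V (W k))) / real (dim (W k)) < 1 + \<delta>"
      then have PW: "real (dim (prod_space ?V (W k))) < (1 + \<delta>) * real (dim (W k))"
        using pos by (simp add: pos_divide_less_eq)
      let ?N = "real (card B)" and ?n = "real (dim (W k))"
      have "{w \<in> W k. \<forall>y\<in>B. y * w \<in> W k} \<subseteq> {w \<in> W k. \<forall>y\<in>?V. y * w \<in> W k}"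
      proof
        fix w assume w: "w \<in> {w \<in> W k. \<forall>y\<in>B. y * w \<in> W k}"
        have "subspace {y. y * w \<in> W k}"
          using W(1)[of k] by (auto simp: subspace_def distrib_right scale_mult_left)
        then have "span B \<subseteq> {y. y * w \<in> W k}"
          using w by (intro span_minimal) auto
        then show "w \<in> {w \<in> W k. \<forall>y\<in>?V. y * w \<in> W k}"
          using w B(2) by auto
      qed
      then have X: "dim {w \<in> W k. \<forall>y\<in>B. y * w \<in> W k} \<le> dim {w \<in> W k. \<forall>y\<in>?V. y * w \<in> W k}"
        by (intro fin_dim_dim_mono fin_dim_subset[OF _ W(2)[of k]]) auto
      have "dim (W k) + card B * dim (W k) \<le> dim {w \<in> W k. \<forall>y\<in>B. y * w \<in> W k}
          + card B * dim (prod_space ?V (W k))"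
        using B span_superset
        by (intro dim_stable_vectors W fin_dim_filtration fin one_in_filtration) auto
      then have "dim (W k) + card B * dim (W k) \<le> dim {w \<in> W k. \<forall>y\<in>?V. y * w \<in> W k}
          + card B * dim (prod_space ?V (W k))"
        using X by linarith
      then have "?n + ?N * ?n \<le> real (dim {w \<in> W k. \<forall>y\<in>?V. y * w \<in> W k})
          + ?N * real (dim (prod_space ?V (W k)))"
        unfolding of_nat_le_iff[where 'a=real, symmetric] by simp
      moreover have "?N * real (dim (prod_space ?V (W k))) \<le> ?N * ((1 + \<delta>) * ?n)"
        using PW by (intro mult_left_mono) auto
      moreover have "?N * ((1 + \<delta>) * ?n) = ?N * ?n + ?N * \<delta> * ?n"
        by (simp add: algebra_simps)
      moreover have "?N * \<delta> * ?n \<le> 1 / real d * ?n"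
      proof (rule mult_right_mono)
        have "?N * \<delta> \<le> real (Suc (card B)) * \<delta>"
          using \<delta> by (intro mult_right_mono) auto
        also have "\<dots> = 1 / real d"
          unfolding \<delta>_def by simp
        finally show "?N * \<delta> \<le> 1 / real d" .
      qed simp
      ultimately have "?n - 1 / real d * ?n \<le> real (dim {w \<in> W k. \<forall>y\<in>?V. y * w \<in> W k})"
        by linarith
      then have "(1 - 1 / real d) * ?n \<le> real (dim {w \<in> W k. \<forall>y\<in>?V. y * w \<in> W k})"
        by (simp add: left_diff_distrib)
      then obtain U where "approx_on S d (dim (W k)) (\<phi> k) U"
        using compression_approx_on(2)[OF dom W(1,2) ec(1-6)] unfolding \<phi>_def by blast
      then show "approximation_of S d (dim (W k)) (\<phi> k)"
        using approx_on_imp_approximation pos by blast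
    qed
  qed
  then show ?thesis
    unfolding linear_sofic_rep_def using pos lin
    by (intro exI[of _ "\<lambda>k. dim (W k)"] exI[of _ \<phi>]) auto
qed

end

section \<open>The theorem\<close>

lemma nonprincipal_le_sequentially:
  assumes "nonprincipal_ultrafilter \<omega>"
  shows "\<omega> \<le> sequentially"
proof (rule filter_leI)
  fix P :: "nat \<Rightarrow> bool"
  assume "eventually P sequentially"
  then obtain N where N: "\<And>k. k \<ge> N \<Longrightarrow> P k"
    unfolding eventually_sequentially by blast
  have "eventually (\<lambda>k. k \<noteq> m) \<omega>" for m
    using assms unfolding nonprincipal_ultrafilter_def by blast
  then have "eventually (\<lambda>k. \<forall>m\<in>{..<N}. k \<noteq> m) \<omega>"
    by (intro eventually_ball_finite) auto
  then show "eventually P \<omega>"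
    by (rule eventually_mono) (use N in \<open>auto simp: not_less[symmetric]\<close>)
qed

theorem theorem1p1:
  fixes scale :: "'k::field \<Rightarrow> 'a::ring_1_no_zero_divisors \<Rightarrow> 'a"
    and S :: "'a set"
    and \<omega> :: "nat filter"
  assumes "assoc_algebra scale"
    and "finite S" and "1 \<in> S" and "assoc_algebra.generating_set scale S"
    and "assoc_algebra.amenable scale"
    and "nonprincipal_ultrafilter \<omega>"
  shows "(\<exists>n \<phi>. assoc_algebra.linear_sofic_rep scale S n \<phi>) \<and>
    (\<forall>n \<phi> \<psi>. assoc_algebra.linear_sofic_rep scale S n \<phi> \<longrightarrow>
      assoc_algebra.linear_sofic_rep scale S n \<psi> \<longrightarrow>
      conjugate \<omega> n \<phi> \<psi>)"
proof -
  interpret assoc_algebra scale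
    by fact
  have le: "\<omega> \<le> sequentially"
    using assms(6) by (rule nonprincipal_le_sequentially)
  have dom: "x = 0 \<or> y = 0" if "x * y = 0" for x y :: 'a
    using that by simp
  have "\<exists>n \<phi>. linear_sofic_rep S n \<phi>"
    by (rule sofic_rep_exists[OF dom _ assms(2,5)]) simp_all
  moreover have "conjugate \<omega> n \<phi> \<psi>"
    if "linear_sofic_rep S n \<phi>" "linear_sofic_rep S n \<psi>" for n \<phi> \<psi>
    by (rule sofic_reps_conjugate[OF assms(2,4,5) one_neq_zero that le])
  ultimately show ?thesis
    by blast
qed

end
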